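(* With notation as in the context: (1) $\Delta_p$ is Galois rigid for all primes $p\geq 5$; (2) $\Delta_4$, $\Delta_6$ and $\Delta_9$ are Galois rigid; (3) $\Gamma_4$ is Galois rigid.
   Context: Let $K\subset S^3$ be the figure-eight knot, with $\pi_1(S^3\setminus K)=\langle\alpha,\beta\mid (\alpha\beta^{-1}\alpha^{-1}\beta)\alpha(\beta^{-1}\alpha\beta\alpha^{-1})=\beta\rangle$, where $\alpha,\beta$ are meridians. For $n\ge 2$ let $Q_n$ be the orbifold obtained by $(n,0)$-Dehn filling on $K$ and $\Delta_n=\pi_1^{\mathrm{orb}}(Q_n)$, i.e. the quotient of $\pi_1(S^3\setminus K)$ by the relation $\alpha^n=1$. Let $M_n$ be the $n$-fold cyclic branched cover of $S^3$ over $K$ and $\Gamma_n=\pi_1(M_n)=[\Delta_n,\Delta_n]$. For $n\ge 4$, $Q_n$ and $M_n$ are closed hyperbolic, so $\Delta_n,\Gamma_n$ are regarded as (via the holonomy, uniquely up to conjugacy) cocompact lattices in $\mathrm{PSL}(2,\mathbb{C})$. For a finitely generated $\Gamma<\mathrm{PSL}(2,\mathbb{C})$ with preimage $\Gamma_1<\mathrm{SL}(2,\mathbb{C})$, the trace field is $K_\Gamma=\mathbb{Q}(\mathrm{tr}\gamma:\gamma\in\Gamma_1)$; $\Gamma$ is called Zariski dense if $\Gamma_1$ is Zariski dense in $\mathrm{SL}(2,\mathbb{C})$. For a lattice, $K_\Gamma$ is a number field; each field embedding $\sigma:K_\Gamma\to\mathbb{C}$ yields a Zariski dense representation $\rho_\sigma:\Gamma\to\mathrm{PSL}(2,\mathbb{C})$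 with $\mathrm{tr}\,\rho_\sigma(\gamma)=\sigma(\mathrm{tr}\,\gamma)$ (up to sign); these are the Galois conjugates of the inclusion. $\Gamma$ is Galois rigid if, up to conjugacy, the only Zariski dense representations $\Gamma\to\mathrm{PSL}(2,\mathbb{C})$ are the Galois conjugates of the inclusion. *)

theory Defs
  imports "HOL-Analysis.Analysis" "HOL-Algebra.Generated_Groups" "HOL-Computational_Algebra.Primes"
begin

text \<open>A letter is (generator, inverted?): generator False = alpha, True = beta.\<close>
type_synonym letter = "bool \<times> bool"
type_synonym word = "letter list"

definition inv_letter :: "letter \<Rightarrow> letter" where
  "inv_letter x = (fst x, \<not> snd x)"

definition gen_a :: letter where "gen_a = (False, False)"
definition gen_A :: letter where "gen_A = (False, True)"
definition gen_b :: letter where "gen_b = (True, False)"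
definition gen_B :: letter where "gen_B = (True, True)"

inductive word_eq :: "word set \<Rightarrow> word \<Rightarrow> word \<Rightarrow> bool" for R where
  refl: "word_eq R w w"
| sym: "word_eq R u v \<Longrightarrow> word_eq R v u"
| trans: "word_eq R u v \<Longrightarrow> word_eq R v w \<Longrightarrow> word_eq R u w"
| cancel: "word_eq R (u @ [x, inv_letter x] @ v) (u @ v)"
| relator: "r \<in> R \<Longrightarrow> word_eq R (u @ r @ v) (u @ v)"

definition word_class :: "word set \<Rightarrow> word \<Rightarrow> word set" where
  "word_class R w = {v. word_eq R v w}"

definition fp_group :: "word set \<Rightarrow> word set monoid" where
  "fp_group R = \<lparr> carrier = range (word_class R),
                  monoid.mult = (\<lambda>X Y. {z. \<exists>x\<in>X. \<exists>y\<in>Y. word_eq R z (x @ y)}),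
                  one = word_class R [] \<rparr>"

text \<open>Figure-eight relation (alpha beta^-1 alpha^-1 beta) alpha (beta^-1 alpha beta alpha^-1) = beta,
  written as a relator (multiplied by beta^-1 on the right).\<close>
definition fig8_relator :: word where
  "fig8_relator = [gen_a, gen_B, gen_A, gen_b, gen_a, gen_B, gen_a, gen_b, gen_A, gen_B]"

definition Delta :: "nat \<Rightarrow> word set monoid" where
  "Delta n = fp_group {fig8_relator, replicate n gen_a}"

text \<open>Gamma_n = [Delta_n, Delta_n], the orbifold fundamental group of the n-fold cyclic branched cover.\<close>
definition Gamma_n :: "nat \<Rightarrow> word set monoid" where
  "Gamma_n n = (Delta n)\<lparr>carrier := derived (Delta n) (carrier (Delta n))\<rparr>"

type_synonym cmat = "complex^2^2"

definition SL2 :: "cmat set" where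
  "SL2 = {A. det A = 1}"

definition PSL2 :: "cmat set monoid" where
  "PSL2 = \<lparr> carrier = {{A, -A} | A. A \<in> SL2},
            monoid.mult = (\<lambda>X Y. {x ** y | x y. x \<in> X \<and> y \<in> Y}),
            one = {mat 1, - mat 1} \<rparr>"

definition preimage_grp :: "('g, 'b) monoid_scheme \<Rightarrow> ('g \<Rightarrow> cmat set) \<Rightarrow> cmat set" where
  "preimage_grp G \<rho> = \<Union> (\<rho> ` carrier G)"

definition poly_fun :: "(cmat \<Rightarrow> complex) \<Rightarrow> bool" where
  "poly_fun f \<longleftrightarrow> (\<exists>(c :: nat \<Rightarrow> nat \<Rightarrow> nat \<Rightarrow> nat \<Rightarrow> complex) N. \<forall>A.
     f A = (\<Sum>i\<le>N. \<Sum>j\<le>N. \<Sum>k\<le>N. \<Sum>l\<le>N. c i j k l *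
              (A$1$1)^i * (A$1$2)^j * (A$2$1)^k * (A$2$2)^l))"

definition zariski_dense_SL2 :: "cmat set \<Rightarrow> bool" where
  "zariski_dense_SL2 S \<longleftrightarrow> S \<subseteq> SL2 \<and>
     (\<forall>f. poly_fun f \<longrightarrow> (\<forall>A\<in>S. f A = 0) \<longrightarrow> (\<forall>A\<in>SL2. f A = 0))"

definition is_rep :: "('g, 'b) monoid_scheme \<Rightarrow> ('g \<Rightarrow> cmat set) \<Rightarrow> bool" where
  "is_rep G \<rho> \<longleftrightarrow> \<rho> \<in> hom G PSL2"

definition zariski_dense_rep :: "('g, 'b) monoid_scheme \<Rightarrow> ('g \<Rightarrow> cmat set) \<Rightarrow> bool" where
  "zariski_dense_rep G \<rho> \<longleftrightarrow> is_rep G \<rho> \<and> zariski_dense_SL2 (preimage_grp G \<rho>)"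

definition is_subfield :: "complex set \<Rightarrow> bool" where
  "is_subfield F \<longleftrightarrow> 0 \<in> F \<and> 1 \<in> F \<and> (\<forall>x\<in>F. \<forall>y\<in>F. x + y \<in> F \<and> x - y \<in> F \<and> x * y \<in> F)
     \<and> (\<forall>x\<in>F. x \<noteq> 0 \<longrightarrow> inverse x \<in> F)"

definition trace_field :: "('g, 'b) monoid_scheme \<Rightarrow> ('g \<Rightarrow> cmat set) \<Rightarrow> complex set" where
  "trace_field G \<rho> = \<Inter> {F. is_subfield F \<and> trace ` preimage_grp G \<rho> \<subseteq> F}"

definition field_embedding :: "complex set \<Rightarrow> (complex \<Rightarrow> complex) \<Rightarrow> bool" where
  "field_embedding K \<sigma> \<longleftrightarrow> \<sigma> 1 = 1 \<and>
     (\<forall>x\<in>K. \<forall>y\<in>K. \<sigma> (x + y) = \<sigma> x + \<sigma> y \<and> \<sigma> (x * y) = \<sigma> x * \<sigma> y)"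

definition galois_conjugate ::
  "('g, 'b) monoid_scheme \<Rightarrow> ('g \<Rightarrow> cmat set) \<Rightarrow> (complex \<Rightarrow> complex) \<Rightarrow> ('g \<Rightarrow> cmat set) \<Rightarrow> bool" where
  "galois_conjugate G \<rho>0 \<sigma> \<rho>' \<longleftrightarrow> field_embedding (trace_field G \<rho>0) \<sigma> \<and>
     zariski_dense_rep G \<rho>' \<and>
     (\<forall>g\<in>carrier G. \<forall>A\<in>\<rho>0 g. \<exists>B\<in>\<rho>' g. trace B = \<sigma> (trace A))"

definition conjugate_reps :: "('g, 'b) monoid_scheme \<Rightarrow> ('g \<Rightarrow> cmat set) \<Rightarrow> ('g \<Rightarrow> cmat set) \<Rightarrow> bool" where
  "conjugate_reps G \<rho> \<rho>' \<longleftrightarrow> (\<exists>C. det C = 1 \<and>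
     (\<forall>g\<in>carrier G. \<rho>' g = (\<lambda>A. C ** A ** matrix_inv C) ` \<rho> g))"

definition galois_rigid :: "('g, 'b) monoid_scheme \<Rightarrow> ('g \<Rightarrow> cmat set) \<Rightarrow> bool" where
  "galois_rigid G \<rho>0 \<longleftrightarrow> (\<forall>\<rho>. zariski_dense_rep G \<rho> \<longrightarrow>
     (\<exists>\<sigma> \<rho>'. galois_conjugate G \<rho>0 \<sigma> \<rho>' \<and> conjugate_reps G \<rho>' \<rho>))"

text \<open>rho0 is faithful, with discrete image (the preimage in SL(2,C) has no accumulation
  point) and cocompact image (SL(2,C) = Gamma_1 K for some compact K).\<close>
definition cocompact_lattice_rep :: "('g, 'b) monoid_scheme \<Rightarrow> ('g \<Rightarrow> cmat set) \<Rightarrow> bool" where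
  "cocompact_lattice_rep G \<rho>0 \<longleftrightarrow> is_rep G \<rho>0 \<and> inj_on \<rho>0 (carrier G) \<and>
     (\<forall>A. \<not> A islimpt preimage_grp G \<rho>0) \<and>
     (\<exists>K. compact K \<and> (\<forall>g\<in>SL2. \<exists>h\<in>preimage_grp G \<rho>0. \<exists>k\<in>K. g = h ** k))"

end

theory Submission
  imports Defs "HOL-Computational_Algebra.Polynomial_Factorial"
begin

text \<open>
  For every Zariski dense \<open>\<rho>\<close> we find an embedding \<open>\<sigma>\<close> of the trace field of \<open>\<rho>0\<close> that carries the
  traces of \<open>\<rho>0\<close> to those of \<open>\<rho>\<close>, so that \<open>\<rho>\<close> itself is a Galois conjugate. For a group generated
  by \<open>g\<close> and \<open>h\<close>, Cayley-Hamilton makes all traces integral polynomials in the traces of the lifts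
  \<open>A\<close>, \<open>B\<close>, \<open>AB\<close>; it is therefore enough to find an isomorphism between the rings which these three
  numbers generate for \<open>\<rho>0\<close> and for \<open>\<rho>\<close>.

  For \<open>\<Delta>\<^sub>n\<close> put \<open>x = tr A = tr B\<close> and \<open>z = tr (A B\<inverse>)\<close>. The figure-eight relation becomes
  \<open>z\<^sup>2 - (x\<^sup>2 - 1) z + (x\<^sup>2 - 1) = 0\<close>, unless \<open>A = B\<close>. Zariski density excludes that \<open>A\<close> has order 2
  or 3 in \<open>PSL(2)\<close> (the image would be dihedral or tetrahedral), and this passes to \<open>\<rho>0\<close> because
  \<open>\<rho>0\<close> is faithful. So, up to sign, \<open>x\<close> is a root of one Eisenstein-irreducible polynomial, and the
  quadratic equation for \<open>z\<close> is irreducible over \<open>\<rat>(x)\<close>: its discriminant \<open>(x\<^sup>2 - 1) (x\<^sup>2 - 5)\<close> is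
  negative at a real conjugate of \<open>x\<close>.

  The group \<open>\<Gamma>\<^sub>4\<close> is the Fibonacci group \<open>F(2,8)\<close>. The traces \<open>t\<^sub>j\<close> of suitable lifts of its
  generators satisfy \<open>t\<^sub>j t\<^bsub>j+1\<^esub> = 1\<close> and \<open>t\<^sub>j + t\<^bsub>j+1\<^esub> = 1\<close>, which determines them up to the Galois
  conjugation of \<open>\<rat>(\<surd>-3)\<close>.
\<close>

subsection \<open>The algebra spanned by two matrices in SL(2)\<close>

text \<open>The adjugate, hence the inverse on \<open>SL2\<close>, in a form that is polynomial in
  the entries.\<close>

definition adj2 :: "cmat \<Rightarrow> cmat" where
  "adj2 A = mat (trace A) - A"

text \<open>For \<open>det P = det Q = 1\<close> these combinations are closed under multiplication,
  so a word in \<open>P\<close>, \<open>Q\<close> and their inverses is computed as a vector of four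
  coefficients. The coefficients need not be unique, as \<open>P\<close> and \<open>Q\<close> may
  commute.\<close>

definition lin :: "cmat \<Rightarrow> cmat \<Rightarrow> complex \<Rightarrow> complex \<Rightarrow> complex \<Rightarrow> complex \<Rightarrow> cmat" where
  "lin P Q a b c d = (\<chi> i j. a * mat 1 $ i $ j + b * P $ i $ j + c * Q $ i $ j + d * (P ** Q) $ i $ j)"

lemmas mat2_simps = vec_eq_iff forall_2 matrix_matrix_mult_def sum_2 mat_def trace_def det_2 UNIV_2

lemma adj2_mult:
  assumes "det A = 1"
  shows "A ** adj2 A = mat 1" "adj2 A ** A = mat 1"
  using assms by (auto simp: adj2_def mat2_simps algebra_simps)

text \<open>Cayley-Hamilton for \<open>P\<close>, and its polarisation, which expresses
  \<open>Q ** P + P ** Q\<close> through \<open>P\<close>, \<open>Q\<close> and the identity, with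
  the traces as coefficients.\<close>

lemma lin_mult_left_gen:
  assumes "det P = 1" "det Q = 1"
  shows "lin P Q a b c d ** P =
    lin P Q (c * (trace (P ** Q) - trace P * trace Q) - b - d * trace Q)
      (a + b * trace P + c * trace Q + d * trace (P ** Q)) (c * trace P + d) (- c)"
  using assms unfolding lin_def mat2_simps
  by (simp, intro conjI; algebra)

lemma lin_mult_right_gen:
  assumes "det P = 1" "det Q = 1"
  shows "lin P Q a b c d ** Q =
    lin P Q (- c) (- d) (a + c * trace Q) (b + d * trace Q)"
  using assms unfolding lin_def mat2_simps
  by (simp, intro conjI; algebra)

lemma lin_mult_adj2_left_gen:
  assumes "det P = 1" "det Q = 1"
  shows "lin P Q a b c d ** adj2 P =
    lin P Q (a * trace P - c * (trace (P ** Q) - trace P * trace Q) + b + d * trace Q)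
      (- (a + c * trace Q + d * trace (P ** Q))) (- d) (d * trace P + c)"
  using assms unfolding lin_def adj2_def mat2_simps
  by (simp, intro conjI; algebra)

lemma lin_mult_adj2_right_gen:
  assumes "det P = 1" "det Q = 1"
  shows "lin P Q a b c d ** adj2 Q =
    lin P Q (a * trace Q + c) (b * trace Q + d) (- a) (- b)"
  using assms unfolding lin_def adj2_def mat2_simps
  by (simp, intro conjI; algebra)

lemma lin_basis:
  "lin P Q 1 0 0 0 = mat 1" "lin P Q 0 1 0 0 = P" "lin P Q 0 0 1 0 = Q" "lin P Q 0 0 0 1 = P ** Q"
  by (simp_all add: lin_def vec_eq_iff)

lemma lin_cong:
  "a = a' \<Longrightarrow> b = b' \<Longrightarrow> c = c' \<Longrightarrow> d = d' \<Longrightarrow> lin P Q a b c d = lin P Q a' b' c' d'"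
  by simp

lemma trace_lin:
  "trace (lin P Q a b c d) = 2 * a + b * trace P + c * trace Q + d * trace (P ** Q)"
  by (simp add: lin_def mat2_simps algebra_simps)

lemma lin_diff:
  "lin P Q a b c d - lin P Q a' b' c' d' = lin P Q (a - a') (b - b') (c - c') (d - d')"
  by (simp add: lin_def vec_eq_iff algebra_simps)

lemma lin_uminus: "- lin P Q a b c d = lin P Q (- a) (- b) (- c) (- d)"
  by (simp add: lin_def vec_eq_iff algebra_simps)

lemma det_uminus2 [simp]: "det (- A :: cmat) = det A"
  by (simp add: det_2)

lemma trace_uminus2 [simp]: "trace (- A :: cmat) = - trace A"
  by (simp add: mat2_simps)

lemma adj2_uminus [simp]: "adj2 (- A) = - adj2 A"
  by (simp add: adj2_def mat2_simps)

lemma adj2_adj2 [simp]: "adj2 (adj2 A) = A"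
  by (simp add: adj2_def mat2_simps)

lemma adj2_mat_1 [simp]: "adj2 (mat 1) = mat 1"
  by (simp add: adj2_def mat2_simps)

lemma adj2_matrix_mult: "adj2 (A ** B) = adj2 B ** adj2 A"
  by (simp add: adj2_def mat2_simps algebra_simps)

lemma mult_uminus2 [simp]:
  "(- A :: cmat) ** B = - (A ** B)" "A ** (- B) = - (A ** B)"
  by (simp_all add: mat2_simps algebra_simps)

lemma adj2_unique:
  assumes "det A = 1" "A ** B = mat 1"
  shows "B = adj2 A"
  by (metis adj2_mult(2) assms matrix_mul_assoc matrix_mul_lid matrix_mul_rid)

lemma trace_mult_adj2: "trace (A ** adj2 B) = trace A * trace B - trace (A ** B)"
  by (simp add: adj2_def mat2_simps algebra_simps)

text \<open>The matrix form of the figure-eight relation, reduced to the basis \<open>1, A, B, AB\<close>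
  by Cayley-Hamilton.\<close>
lemma fig8_matrix_identity:
  assumes "det A = 1" "det B = 1" "trace A = x" "trace B = x" "trace (A ** adj2 B) = z"
  shows "A ** adj2 B ** adj2 A ** B ** A - B ** A ** adj2 B ** adj2 A ** B =
    lin A B 0 (z^2 - (x^2 - 1) * z + (x^2 - 1)) (- (z^2 - (x^2 - 1) * z + (x^2 - 1))) 0"
proof -
  have w: "trace (A ** B) = x * x - z"
    using assms trace_mult_adj2[of A B] by (simp add: algebra_simps)
  note * = lin_mult_left_gen[OF assms(1,2)] lin_mult_right_gen[OF assms(1,2)]
    lin_mult_adj2_left_gen[OF assms(1,2)] lin_mult_adj2_right_gen[OF assms(1,2)]
  have "A ** adj2 B ** adj2 A ** B ** A - B ** A ** adj2 B ** adj2 A ** B =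
     lin A B 0 1 0 0 ** adj2 B ** adj2 A ** B ** A - lin A B 0 0 1 0 ** A ** adj2 B ** adj2 A ** B"
    by (simp add: lin_basis)
  also have "\<dots> = lin A B 0 (z^2 - (x^2 - 1) * z + (x^2 - 1)) (- (z^2 - (x^2 - 1) * z + (x^2 - 1))) 0"
    by (simp add: * lin_diff assms(3,4) w)
      (rule lin_cong; simp add: algebra_simps power2_eq_square)
  finally show ?thesis .
qed

subsection \<open>Polynomial functions and Zariski density\<close>

text \<open>An arbitrary finite set of exponents replaces the box \<open>{..N}\<close>, so that sums
  and products of polynomial functions need no common bound.\<close>

lemma poly_fun_iff_finite_sum:
  "poly_fun f \<longleftrightarrow> (\<exists>S c. finite S \<and> (\<forall>A. f A =
     (\<Sum>(i, j, k, l)\<in>S. c i j k l * (A$1$1)^i * (A$1$2)^j * (A$2$1)^k * (A$2$2)^l)))"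
proof
  assume "poly_fun f"
  then obtain c N where *: "\<And>A. f A = (\<Sum>i\<le>N. \<Sum>j\<le>N. \<Sum>k\<le>N. \<Sum>l\<le>N. c i j k l *
              (A$1$1)^i * (A$1$2)^j * (A$2$1)^k * (A$2$2)^l)"
    unfolding poly_fun_def by blast
  then show "\<exists>S c. finite S \<and> (\<forall>A. f A =
     (\<Sum>(i, j, k, l)\<in>S. c i j k l * (A$1$1)^i * (A$1$2)^j * (A$2$1)^k * (A$2$2)^l))"
    by (intro exI[of _ "{..N} \<times> {..N} \<times> {..N} \<times> {..N}"] exI[of _ c])
       (simp add: sum.cartesian_product split_def)
next
  assume "\<exists>S c. finite S \<and> (\<forall>A. f A =
     (\<Sum>(i, j, k, l)\<in>S. c i j k l * (A$1$1)^i * (A$1$2)^j * (A$2$1)^k * (A$2$2)^l))"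
  then obtain S :: "(nat \<times> nat \<times> nat \<times> nat) set" and c where S: "finite S" and *: "\<And>A. f A =
     (\<Sum>(i, j, k, l)\<in>S. c i j k l * (A$1$1)^i * (A$1$2)^j * (A$2$1)^k * (A$2$2)^l)"
    by blast
  define N where "N = Max (insert 0 ((\<lambda>(i, j, k, l). i + j + k + l) ` S))"
  have N: "i + j + k + l \<le> N" if "(i, j, k, l) \<in> S" for i j k l
    unfolding N_def using S that by (intro Max_ge) force+
  let ?B = "{..N} \<times> {..N} \<times> {..N} \<times> {..N}"
  have sub: "S \<subseteq> ?B"
    using N by force
  define c' where "c' i j k l = (if (i, j, k, l) \<in> S then c i j k l else 0)" for i j k l
  have "f A = (\<Sum>i\<le>N. \<Sum>j\<le>N. \<Sum>k\<le>N. \<Sum>l\<le>N. c' i j k l *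
              (A$1$1)^i * (A$1$2)^j * (A$2$1)^k * (A$2$2)^l)" for A
  proof -
    have "f A = (\<Sum>(i, j, k, l)\<in>?B. c' i j k l * (A$1$1)^i * (A$1$2)^j * (A$2$1)^k * (A$2$2)^l)"
      unfolding * by (rule sum.mono_neutral_cong_left) (use sub in \<open>auto simp: c'_def\<close>)
    then show ?thesis
      by (simp add: sum.cartesian_product split_def)
  qed
  then show "poly_fun f"
    unfolding poly_fun_def by blast
qed

lemma poly_fun_monomial:
  "poly_fun (\<lambda>A. c * (A$1$1)^i * (A$1$2)^j * (A$2$1)^k * (A$2$2)^l)"
  unfolding poly_fun_iff_finite_sum
  by (rule exI[of _ "{(i, j, k, l)}"], rule exI[of _ "\<lambda>_ _ _ _. c"]) auto

lemma poly_fun_const: "poly_fun (\<lambda>A. c)"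
  using poly_fun_monomial[of c 0 0 0 0] by simp

lemma poly_fun_entry: "poly_fun (\<lambda>A. A $ i $ j)"
  using poly_fun_monomial[of 1 1 0 0 0] poly_fun_monomial[of 1 0 1 0 0]
    poly_fun_monomial[of 1 0 0 1 0] poly_fun_monomial[of 1 0 0 0 1]
    exhaust_2[of i] exhaust_2[of j] by auto

lemma poly_fun_add:
  assumes "poly_fun f" "poly_fun g"
  shows "poly_fun (\<lambda>A. f A + g A)"
proof -
  obtain S c where S: "finite S" and f: "\<And>A. f A =
     (\<Sum>(i, j, k, l)\<in>S. c i j k l * (A$1$1)^i * (A$1$2)^j * (A$2$1)^k * (A$2$2)^l)"
    using assms(1) unfolding poly_fun_iff_finite_sum by blast
  obtain T d where T: "finite T" and g: "\<And>A. g A =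
     (\<Sum>(i, j, k, l)\<in>T. d i j k l * (A$1$1)^i * (A$1$2)^j * (A$2$1)^k * (A$2$2)^l)"
    using assms(2) unfolding poly_fun_iff_finite_sum by blast
  define c' where "c' i j k l = (if (i, j, k, l) \<in> S then c i j k l else 0)" for i j k l
  define d' where "d' i j k l = (if (i, j, k, l) \<in> T then d i j k l else 0)" for i j k l
  have f': "f A = (\<Sum>(i, j, k, l)\<in>S \<union> T. c' i j k l * (A$1$1)^i * (A$1$2)^j * (A$2$1)^k * (A$2$2)^l)" for A
    unfolding f by (rule sum.mono_neutral_cong_left) (use S T in \<open>auto simp: c'_def\<close>)
  have g': "g A = (\<Sum>(i, j, k, l)\<in>S \<union> T. d' i j k l * (A$1$1)^i * (A$1$2)^j * (A$2$1)^k * (A$2$2)^l)" for A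
    unfolding g by (rule sum.mono_neutral_cong_left) (use S T in \<open>auto simp: d'_def\<close>)
  show ?thesis
    unfolding poly_fun_iff_finite_sum
    by (intro exI[of _ "S \<union> T"] exI[of _ "\<lambda>i j k l. c' i j k l + d' i j k l"])
       (use S T in \<open>simp add: f' g' sum.distrib[symmetric] split_def algebra_simps\<close>)
qed

lemma poly_fun_sum:
  assumes "finite S" "\<And>i. i \<in> S \<Longrightarrow> poly_fun (f i)"
  shows "poly_fun (\<lambda>A. \<Sum>i\<in>S. f i A)"
  using assms by (induction S rule: finite_induct) (auto intro: poly_fun_const poly_fun_add)

lemma poly_fun_mult:
  assumes "poly_fun f" "poly_fun g"
  shows "poly_fun (\<lambda>A. f A * g A)"
proof -
  obtain S c where S: "finite S" and f: "\<And>A. f A =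
     (\<Sum>(i, j, k, l)\<in>S. c i j k l * (A$1$1)^i * (A$1$2)^j * (A$2$1)^k * (A$2$2)^l)"
    using assms(1) unfolding poly_fun_iff_finite_sum by blast
  obtain T d where T: "finite T" and g: "\<And>A. g A =
     (\<Sum>(i, j, k, l)\<in>T. d i j k l * (A$1$1)^i * (A$1$2)^j * (A$2$1)^k * (A$2$2)^l)"
    using assms(2) unfolding poly_fun_iff_finite_sum by blast
  have "poly_fun (\<lambda>A. \<Sum>s\<in>S. \<Sum>t\<in>T. (case s of (i, j, k, l) \<Rightarrow> case t of (i', j', k', l') \<Rightarrow>
      (c i j k l * d i' j' k' l') * (A$1$1)^(i + i') * (A$1$2)^(j + j') * (A$2$1)^(k + k') * (A$2$2)^(l + l')))"
    using S T by (intro poly_fun_sum) (auto intro: poly_fun_monomial)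
  then show ?thesis
    by (simp add: f g sum_product split_def power_add mult_ac)
qed

lemma poly_fun_diff:
  assumes "poly_fun f" "poly_fun g"
  shows "poly_fun (\<lambda>A. f A - g A)"
  using poly_fun_add[OF assms(1) poly_fun_mult[OF poly_fun_const[of "-1"] assms(2)]] by simp

lemma poly_fun_prod:
  assumes "finite S" "\<And>i. i \<in> S \<Longrightarrow> poly_fun (f i)"
  shows "poly_fun (\<lambda>A. \<Prod>i\<in>S. f i A)"
  using assms by (induction S rule: finite_induct) (auto intro: poly_fun_const poly_fun_mult)

lemmas poly_fun_intros = poly_fun_const poly_fun_entry poly_fun_add poly_fun_mult poly_fun_diff

section \<open>Finite conjugation orbits under a Zariski dense set\<close>

lemma zariski_dense_vanish:
  assumes "zariski_dense_SL2 S" "poly_fun f" "\<And>A. A \<in> S \<Longrightarrow> f A = 0" "det A = 1"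
  shows "f A = 0"
  using assms unfolding zariski_dense_SL2_def SL2_def by blast

text \<open>Some value is taken infinitely often, and a nonconstant polynomial cannot do
  this.\<close>

lemma quadratic_finite_range_const:
  fixes a b c :: complex
  assumes "finite V" "\<And>s. a + b * s + c * s^2 \<in> V"
  shows "b = 0" "c = 0"
proof -
  have "finite (UNIV :: complex set) \<or> (\<exists>v\<in>V. infinite {s. a + b * s + c * s^2 = v})"
  proof (rule ccontr)
    assume *: "\<not> ?thesis"
    then have "finite (\<Union>v\<in>V. {s. a + b * s + c * s^2 = v})"
      using assms(1) by blast
    moreover have "(\<Union>v\<in>V. {s. a + b * s + c * s^2 = v}) = UNIV"
      using assms(2) by auto
    ultimately show False using * by simp
  qed
  then obtain v where "infinite {s. a + b * s + c * s^2 = v}"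
    using infinite_UNIV_char_0 by blast
  then have "infinite {s. poly [:a - v, b, c:] s = 0}"
    by (rule infinite_super[rotated]) (auto simp: algebra_simps power2_eq_square)
  then have "[:a - v, b, c:] = 0"
    using poly_roots_finite by blast
  then show "b = 0" "c = 0" by auto
qed

text \<open>That the \<open>(1,2)\<close> entry of a conjugate of \<open>M\<close> lies in a finite
  set is a polynomial condition, the vanishing of \<open>f\<close> below, so it passes from
  \<open>S\<close> to all of SL(2). There one-parameter families make this entry a quadratic
  polynomial with finite range, hence constant.\<close>

lemma zariski_dense_finite_conj_scalar:
  assumes S: "zariski_dense_SL2 S" and X: "finite X"
    and stable: "\<And>g M. g \<in> S \<Longrightarrow> M \<in> X \<Longrightarrow> g ** M ** adj2 g \<in> X"
    and M: "M \<in> X"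
  shows "M = mat (M$1$1)"
proof -
  define f where "f g = (\<Prod>N\<in>X. (g ** M ** adj2 g)$1$2 - N$1$2)" for g
  have "poly_fun f"
    unfolding f_def adj2_def matrix_matrix_mult_def sum_2 trace_def mat_def
    by (intro poly_fun_prod[OF X]) (simp, intro poly_fun_intros)
  moreover have "f g = 0" if "g \<in> S" for g
    unfolding f_def using X stable[OF that M] by (intro prod_zero) auto
  ultimately have 0: "f g = 0" if "det g = 1" for g
    using zariski_dense_vanish[OF S] that by blast
  have *: "(g ** M ** adj2 g)$1$2 \<in> (\<lambda>N. N$1$2) ` X" if "det g = 1" for g
    using 0[OF that] X unfolding f_def by auto
  have fin: "finite ((\<lambda>N. N$1$2) ` X)" using X by simp
  have 1: "M$1$2 + (M$2$2 - M$1$1) * s + (- M$2$1) * s^2 \<in> (\<lambda>N. N$1$2) ` X" for s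
  proof -
    define g :: cmat where "g = vector [vector [1, s], vector [0, 1]]"
    have "det g = 1" "(g ** M ** adj2 g)$1$2 = M$1$2 + (M$2$2 - M$1$1) * s + (- M$2$1) * s^2"
      unfolding g_def adj2_def by (auto simp: mat2_simps algebra_simps power2_eq_square)
    then show ?thesis using *[of g] by simp
  qed
  \<comment> \<open>Upper unipotents times the Weyl element; this exchanges the roles of
    \<open>M$1$2\<close> and \<open>- M$2$1\<close>.\<close>
  have 2: "- M$2$1 + (M$1$1 - M$2$2) * s + M$1$2 * s^2 \<in> (\<lambda>N. N$1$2) ` X" for s
  proof -
    define g :: cmat where "g = vector [vector [s, -1], vector [1, 0]]"
    have "det g = 1" "(g ** M ** adj2 g)$1$2 = - M$2$1 + (M$1$1 - M$2$2) * s + M$1$2 * s^2"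
      unfolding g_def adj2_def by (auto simp: mat2_simps algebra_simps power2_eq_square)
    then show ?thesis using *[of g] by simp
  qed
  have "M$2$2 - M$1$1 = 0" "- M$2$1 = 0" "M$1$2 = 0"
    using quadratic_finite_range_const[OF fin 1] quadratic_finite_range_const[OF fin 2] by auto
  then show ?thesis
    by (simp add: vec_eq_iff forall_2 mat_def)
qed

lemma matrix_add_distribs:
  "(A + B :: cmat) ** C = A ** C + B ** C" "C ** (A + B) = C ** A + C ** B"
  by (simp_all add: mat2_simps algebra_simps)

lemma lin_commute:
  assumes "P ** N = N ** P" "Q ** N = N ** Q"
  shows "lin P Q a b c d ** N = N ** lin P Q a b c d"
proof -
  have lin: "lin P Q a b c d = mat a + mat b ** P + mat c ** Q + mat d ** (P ** Q)"
    by (simp add: lin_def mat2_simps)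
  have mat: "mat t ** N = N ** mat t" for t
    by (simp add: mat2_simps)
  have PQ: "P ** Q ** N = N ** (P ** Q)"
    by (simp only: matrix_mul_assoc[symmetric] assms(2), simp only: matrix_mul_assoc assms(1))
  have smul: "mat t ** M ** N = N ** (mat t ** M)" if "M ** N = N ** M" for t M
    by (simp only: matrix_mul_assoc[symmetric] that, simp only: matrix_mul_assoc mat)
  show ?thesis
    by (simp only: lin matrix_add_distribs smul[OF assms(1)] smul[OF assms(2)] smul[OF PQ] mat[of a])
qed

text \<open>If \<open>P\<close> and \<open>Q\<close> commuted, they would commute with all of
  \<open>S\<close>, so \<open>{P}\<close> and \<open>{Q}\<close> would be stable under conjugation
  and \<open>P\<close>, \<open>Q\<close> scalar. Then \<open>g$1$2\<close> would vanish on
  \<open>S\<close>, and by density on all of SL(2).\<close>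

lemma zariski_dense_not_commuting_span:
  assumes S: "zariski_dense_SL2 S" and det: "det P = 1" "det Q = 1"
    and span: "\<And>g. g \<in> S \<Longrightarrow> \<exists>a b c d. g = lin P Q a b c d"
  shows "P ** Q \<noteq> Q ** P"
proof
  assume comm: "P ** Q = Q ** P"
  have SL: "det g = 1" if "g \<in> S" for g
    using S that unfolding zariski_dense_SL2_def SL2_def by auto
  have "lin P Q a b c d ** P = P ** lin P Q a b c d" "lin P Q a b c d ** Q = Q ** lin P Q a b c d" for a b c d
    using comm by (auto intro!: lin_commute)
  then have gP: "g ** P = P ** g" and gQ: "g ** Q = Q ** g" if "g \<in> S" for g
    using span[OF that] by auto
  have conj_id: "g ** M ** adj2 g = M" if "g ** M = M ** g" "det g = 1" for g M
    by (simp only: that(1), simp add: matrix_mul_assoc[symmetric] adj2_mult that(2))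
  have off_diag: "(mat t :: cmat)$1$2 = 0" for t
    by (simp add: mat_def)
  have "P = mat (P$1$1)"
    by (rule zariski_dense_finite_conj_scalar[OF S, of "{P}"])
       (use conj_id gP SL in auto)
  then have P: "P$1$2 = 0" using off_diag by metis
  have "Q = mat (Q$1$1)"
    by (rule zariski_dense_finite_conj_scalar[OF S, of "{Q}"])
       (use conj_id gQ SL in auto)
  then have Q: "Q$1$2 = 0" using off_diag by metis
  have "lin P Q a b c d $1$2 = 0" for a b c d
    by (simp add: lin_def P Q matrix_matrix_mult_def sum_2 mat_def)
  then have zero: "g$1$2 = 0" if "g \<in> S" for g
    using span[OF that] by metis
  have "(vector [vector [1, 1], vector [0, 1]] :: cmat)$1$2 = 0"
    by (rule zariski_dense_vanish[OF S poly_fun_entry zero]) (simp_all add: det_2)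
  then show False by simp
qed

subsection \<open>Representations and their lifts\<close>

lemma rep_lift:
  assumes "is_rep G \<rho>" "g \<in> carrier G"
  obtains A where "det A = 1" "\<rho> g = {A, - A}"
  using assms unfolding is_rep_def hom_def PSL2_def SL2_def by fastforce

lemma rep_eq_lift:
  assumes "is_rep G \<rho>" "g \<in> carrier G" "A \<in> \<rho> g"
  shows "\<rho> g = {A, - A}" "det A = 1"
proof -
  obtain B where B: "det B = 1" "\<rho> g = {B, - B}" using rep_lift[OF assms(1,2)] .
  then have "A = B \<or> A = - B" using assms(3) by blast
  then show "\<rho> g = {A, - A}" "det A = 1"
    using B by (elim disjE; simp add: insert_commute)+
qed

lemma rep_mult:
  assumes "is_rep G \<rho>" "g \<in> carrier G" "h \<in> carrier G" "A \<in> \<rho> g" "B \<in> \<rho> h"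
  shows "A ** B \<in> \<rho> (g \<otimes>\<^bsub>G\<^esub> h)"
proof -
  have "\<rho> (g \<otimes>\<^bsub>G\<^esub> h) = {x ** y | x y. x \<in> \<rho> g \<and> y \<in> \<rho> h}"
    using assms(1-3) unfolding is_rep_def hom_def PSL2_def by auto
  then show ?thesis using assms(4,5) by auto
qed

lemma rep_one:
  assumes "group G" "is_rep G \<rho>"
  shows "\<rho> \<one>\<^bsub>G\<^esub> = {mat 1, - mat 1}"
proof -
  interpret group G by fact
  obtain A where A: "det A = 1" "\<rho> \<one>\<^bsub>G\<^esub> = {A, - A}"
    using rep_lift[OF assms(2)] by blast
  have "A ** A \<in> \<rho> \<one>\<^bsub>G\<^esub>"
    using rep_mult[OF assms(2), of "\<one>\<^bsub>G\<^esub>" "\<one>\<^bsub>G\<^esub>" A A] A by simp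
  then have "A ** A = A \<or> A ** A = - A" using A by auto
  moreover have "adj2 A ** (A ** A) = A"
    by (simp only: matrix_mul_assoc adj2_mult[OF A(1)] matrix_mul_lid)
  ultimately have "A = adj2 A ** A \<or> A = - (adj2 A ** A)"
    by (metis mult_uminus2(2))
  then have "A = mat 1 \<or> A = - mat 1"
    by (simp only: adj2_mult[OF A(1)])
  then show ?thesis unfolding A(2) by (elim disjE) (simp_all add: insert_commute)
qed

lemma rep_inv:
  assumes "group G" "is_rep G \<rho>" "g \<in> carrier G" "A \<in> \<rho> g"
  shows "adj2 A \<in> \<rho> (inv\<^bsub>G\<^esub> g)"
proof -
  interpret group G by fact
  obtain B where B: "det B = 1" "\<rho> (inv\<^bsub>G\<^esub> g) = {B, - B}"
    using rep_lift[OF assms(2), of "inv\<^bsub>G\<^esub> g"] assms(3) by blast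
  have A: "det A = 1" using rep_eq_lift[OF assms(2-4)] by simp
  have "A ** B \<in> \<rho> (g \<otimes>\<^bsub>G\<^esub> inv\<^bsub>G\<^esub> g)"
    using assms(3,4) B by (intro rep_mult[OF assms(2)]) auto
  then have "A ** B = mat 1 \<or> A ** B = - mat 1"
    using rep_one[OF assms(1,2)] assms(3) by simp
  then have "A ** B = mat 1 \<or> A ** (- B) = mat 1"
    by (metis mult_uminus2(2) minus_minus)
  then have "B = adj2 A \<or> - B = adj2 A"
    using adj2_unique[OF A] by blast
  then show ?thesis using B(2) by (metis insertI1 insertI2)
qed

lemma rep_eq_if_common_lift:
  assumes "is_rep G \<rho>" "inj_on \<rho> (carrier G)" "g \<in> carrier G" "h \<in> carrier G"
    "A \<in> \<rho> g" "A \<in> \<rho> h"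
  shows "g = h"
proof (rule inj_onD[OF assms(2) _ assms(3,4)])
  show "\<rho> g = \<rho> h"
    using rep_eq_lift(1)[OF assms(1,3,5)] rep_eq_lift(1)[OF assms(1,4,6)] by simp
qed

text \<open>Choices of lifts need not be multiplicative, so the induction only provides some pair of
  lifts of \<open>k\<close>. Both are values of the same word in the two pairs of generators, which
  is why \<open>\<Phi>\<close> can compare them.\<close>

lemma rep_generate_pair_induct:
  assumes G: "group G" "is_rep G \<rho>0" "is_rep G \<rho>" "g \<in> carrier G" "h \<in> carrier G"
    and gen: "carrier G \<subseteq> generate G {g, h}"
    and P: "P0 \<in> \<rho>0 g" "P \<in> \<rho> g" and Q: "Q0 \<in> \<rho>0 h" "Q \<in> \<rho> h"
    and base: "\<Phi> (mat 1) (mat 1)" "\<Phi> P0 P" "\<Phi> Q0 Q" "\<Phi> (adj2 P0) (adj2 P)" "\<Phi> (adj2 Q0) (adj2 Q)"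
    and mult: "\<And>M0 M N0 N. \<Phi> M0 M \<Longrightarrow> \<Phi> N0 N \<Longrightarrow> \<Phi> (M0 ** N0) (M ** N)"
    and k: "k \<in> carrier G"
  shows "\<exists>M0\<in>\<rho>0 k. \<exists>M\<in>\<rho> k. \<Phi> M0 M"
proof -
  interpret group G by fact
  have "k \<in> generate G {g, h}" using gen k by blast
  then show ?thesis
  proof (induction rule: generate.induct)
    case one
    then show ?case using rep_one[OF G(1,2)] rep_one[OF G(1,3)] base(1) by blast
  next
    case (incl k)
    then consider "k = g" | "k = h" by blast
    then show ?case
      by cases (use P Q base(2,3) in \<open>simp_all only:, blast+\<close>)
  next
    case (inv k)
    then consider "k = g" | "k = h" by blast
    then show ?case
    proof cases
      case 1
      show ?thesis
        unfolding 1 using rep_inv[OF G(1,2,4) P(1)] rep_inv[OF G(1,3,4) P(2)] base(4) by blast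
    next
      case 2
      show ?thesis
        unfolding 2 using rep_inv[OF G(1,2,5) Q(1)] rep_inv[OF G(1,3,5) Q(2)] base(5) by blast
    qed
  next
    case (eng k l)
    have kl: "k \<in> carrier G" "l \<in> carrier G"
      using eng(1,2) generate_in_carrier[of "{g, h}"] G(4,5) by blast+
    obtain M0 M N0 N where "M0 \<in> \<rho>0 k" "M \<in> \<rho> k" "\<Phi> M0 M" "N0 \<in> \<rho>0 l" "N \<in> \<rho> l" "\<Phi> N0 N"
      using eng(3,4) by blast
    then show ?case
      using rep_mult[OF G(2) kl, of M0 N0] rep_mult[OF G(3) kl, of M N] mult[of M0 M N0 N] by blast
  qed
qed

lemma rep_generate_induct:
  assumes G: "group G" "is_rep G \<rho>" "g \<in> carrier G" "h \<in> carrier G"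
    and gen: "carrier G \<subseteq> generate G {g, h}"
    and PQ: "P \<in> \<rho> g" "Q \<in> \<rho> h"
    and base: "\<Phi> (mat 1)" "\<Phi> P" "\<Phi> Q" "\<Phi> (adj2 P)" "\<Phi> (adj2 Q)"
    and mult: "\<And>M N. \<Phi> M \<Longrightarrow> \<Phi> N \<Longrightarrow> \<Phi> (M ** N)"
    and minus: "\<And>M. \<Phi> M \<Longrightarrow> \<Phi> (- M)"
    and M: "M \<in> preimage_grp G \<rho>"
  shows "\<Phi> M"
proof -
  obtain k where k: "k \<in> carrier G" "M \<in> \<rho> k"
    using M unfolding preimage_grp_def by blast
  have "\<exists>M0\<in>\<rho> k. \<exists>M\<in>\<rho> k. \<Phi> M"
    using rep_generate_pair_induct[of G \<rho> \<rho> g h P P Q Q "\<lambda>_ M. \<Phi> M"] assms k(1) by blast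
  then show ?thesis
    using rep_eq_lift(1)[OF G(2) k] minus[of "- M"] by auto
qed

section \<open>Transporting traces along a ring isomorphism\<close>

lemma lin_mult_lin:
  "lin P Q a b c d ** lin P Q a' b' c' d' =
    lin P Q a b c d ** mat a' + lin P Q a b c d ** P ** mat b' + lin P Q a b c d ** Q ** mat c'
      + lin P Q a b c d ** P ** Q ** mat d'"
proof -
  have "lin P Q a' b' c' d' = mat a' + P ** mat b' + Q ** mat c' + P ** Q ** mat d'"
    by (simp add: lin_def mat2_simps algebra_simps)
  then show ?thesis
    by (simp add: matrix_add_distribs matrix_mul_assoc)
qed

lemma lin_mult_mat: "lin P Q a b c d ** mat t = lin P Q (a * t) (b * t) (c * t) (d * t)"
  by (simp add: lin_def mat2_simps algebra_simps)

lemma lin_add: "lin P Q a b c d + lin P Q a' b' c' d' = lin P Q (a + a') (b + b') (c + c') (d + d')"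
  by (simp add: lin_def mat2_simps algebra_simps)

text \<open>A subring of \<open>\<complex> \<times> \<complex>\<close> that is the graph of a bijection; it encodes an isomorphism
  between two subrings of \<open>\<complex>\<close>.\<close>
definition ring_iso_graph :: "(complex \<times> complex) set \<Rightarrow> bool" where
  "ring_iso_graph J \<longleftrightarrow> (1, 1) \<in> J \<and>
     (\<forall>a b c d. (a, b) \<in> J \<longrightarrow> (c, d) \<in> J \<longrightarrow> (a - c, b - d) \<in> J \<and> (a * c, b * d) \<in> J) \<and>
     (\<forall>a b. (a, b) \<in> J \<longrightarrow> (a = 0 \<longleftrightarrow> b = 0))"

lemma ring_iso_graph_closed:
  assumes "ring_iso_graph J"
  shows "(0, 0) \<in> J" "(1, 1) \<in> J"
    "(a, b) \<in> J \<Longrightarrow> (- a, - b) \<in> J"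
    "(a, b) \<in> J \<Longrightarrow> (c, d) \<in> J \<Longrightarrow> (a + c, b + d) \<in> J"
    "(a, b) \<in> J \<Longrightarrow> (c, d) \<in> J \<Longrightarrow> (a - c, b - d) \<in> J"
    "(a, b) \<in> J \<Longrightarrow> (c, d) \<in> J \<Longrightarrow> (a * c, b * d) \<in> J"
proof -
  note J = assms[unfolded ring_iso_graph_def]
  have sub: "\<And>a b c d. (a, b) \<in> J \<Longrightarrow> (c, d) \<in> J \<Longrightarrow> (a - c, b - d) \<in> J"
    using J by blast
  show one: "(1, 1) \<in> J" using J by blast
  show zero: "(0, 0) \<in> J" using sub[OF one one] by simp
  have neg: "\<And>a b. (a, b) \<in> J \<Longrightarrow> (- a, - b) \<in> J" using sub[OF zero] by simp
  show "(a, b) \<in> J \<Longrightarrow> (- a, - b) \<in> J" by (rule neg)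
  show "(a, b) \<in> J \<Longrightarrow> (c, d) \<in> J \<Longrightarrow> (a + c, b + d) \<in> J"
    using sub[of a b "- c" "- d"] neg[of c d] by simp
  show "(a, b) \<in> J \<Longrightarrow> (c, d) \<in> J \<Longrightarrow> (a - c, b - d) \<in> J" by (rule sub)
  show "(a, b) \<in> J \<Longrightarrow> (c, d) \<in> J \<Longrightarrow> (a * c, b * d) \<in> J" using J by blast
qed

text \<open>The isomorphism extends to fraction fields: the fractions of pairs in \<open>J\<close>
  form the graph \<open>K\<close>. That \<open>J\<close> matches zero with zero only keeps
  denominators nonzero on both sides and makes \<open>K\<close> single-valued.\<close>

lemma ring_iso_graph_extends_to_field:
  assumes J: "ring_iso_graph J"
  obtains F \<sigma> where "is_subfield F" "fst ` J \<subseteq> F" "field_embedding F \<sigma>"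
    "\<And>a b. (a, b) \<in> J \<Longrightarrow> \<sigma> a = b"
proof -
  note cl = ring_iso_graph_closed[OF J]
  have iff: "a = 0 \<longleftrightarrow> b = 0" if "(a, b) \<in> J" for a b
    using J that unfolding ring_iso_graph_def by blast
  define K where "K = {(a / c, b / d) | a b c d. (a, b) \<in> J \<and> (c, d) \<in> J \<and> c \<noteq> 0}"
  have KI: "(a / c, b / d) \<in> K" if "(a, b) \<in> J" "(c, d) \<in> J" "c \<noteq> 0" for a b c d
    using that unfolding K_def by blast
  have KE: "\<exists>a b c d. u = a / c \<and> v = b / d \<and> (a, b) \<in> J \<and> (c, d) \<in> J \<and> c \<noteq> 0 \<and> d \<noteq> 0"
    if "(u, v) \<in> K" for u v
    using that iff unfolding K_def by blast
  have sub: "(u - u', v - v') \<in> K" and mul: "(u * u', v * v') \<in> K" and add: "(u + u', v + v') \<in> K"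
    if uv: "(u, v) \<in> K" "(u', v') \<in> K" for u v u' v'
  proof -
    obtain a b c d where 1: "u = a / c" "v = b / d" "(a, b) \<in> J" "(c, d) \<in> J" "c \<noteq> 0" "d \<noteq> 0"
      using KE[OF uv(1)] by blast
    obtain a' b' c' d' where 2: "u' = a' / c'" "v' = b' / d'" "(a', b') \<in> J" "(c', d') \<in> J" "c' \<noteq> 0" "d' \<noteq> 0"
      using KE[OF uv(2)] by blast
    have "((a * c' - a' * c) / (c * c'), (b * d' - b' * d) / (d * d')) \<in> K"
      using 1 2 by (intro KI cl) auto
    then show "(u - u', v - v') \<in> K"
      unfolding 1(1,2) 2(1,2) diff_frac_eq[OF 1(5) 2(5)] diff_frac_eq[OF 1(6) 2(6)] .
    have "((a * c' + a' * c) / (c * c'), (b * d' + b' * d) / (d * d')) \<in> K"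
      using 1 2 by (intro KI cl) auto
    then show "(u + u', v + v') \<in> K"
      unfolding 1(1,2) 2(1,2) add_frac_eq[OF 1(5) 2(5)] add_frac_eq[OF 1(6) 2(6)] .
    have "((a * a') / (c * c'), (b * b') / (d * d')) \<in> K"
      using 1 2 by (intro KI cl) auto
    then show "(u * u', v * v') \<in> K" using 1 2 by simp
  qed
  have inverse: "(inverse u, inverse v) \<in> K" if uv: "(u, v) \<in> K" "u \<noteq> 0" for u v
  proof -
    obtain a b c d where 1: "u = a / c" "v = b / d" "(a, b) \<in> J" "(c, d) \<in> J" "c \<noteq> 0" "d \<noteq> 0"
      using KE[OF uv(1)] by blast
    have "(c / a, d / b) \<in> K" using 1 uv(2) by (intro KI) auto
    then show ?thesis using 1 by simp
  qed
  have JK: "(a, b) \<in> K" if "(a, b) \<in> J" for a b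
    using KI[OF that cl(2)] by simp
  have zero: "v = 0" if "(0, v) \<in> K" for v
    using KE[OF that] iff by (metis divide_eq_0_iff)
  have uniq: "v = v'" if "(u, v) \<in> K" "(u, v') \<in> K" for u v v'
    using zero[of "v - v'"] sub[OF that] by simp
  define \<sigma> where "\<sigma> u = (THE v. (u, v) \<in> K)" for u
  have \<sigma>: "\<sigma> u = v" if "(u, v) \<in> K" for u v
    unfolding \<sigma>_def using that uniq by blast
  have F: "u \<in> fst ` K \<longleftrightarrow> (\<exists>v. (u, v) \<in> K)" for u by force
  show ?thesis
  proof
    show "is_subfield (fst ` K)"
      unfolding is_subfield_def
    proof (intro conjI ballI impI)
      show "0 \<in> fst ` K" "1 \<in> fst ` K"
        unfolding F using JK[OF cl(1)] JK[OF cl(2)] by blast+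
    next
      fix x y assume "x \<in> fst ` K" "y \<in> fst ` K"
      then obtain v w where "(x, v) \<in> K" "(y, w) \<in> K" unfolding F by blast
      then show "x + y \<in> fst ` K" "x - y \<in> fst ` K" "x * y \<in> fst ` K"
        unfolding F using add[of x v y w] sub[of x v y w] mul[of x v y w] by blast+
    next
      fix x assume "x \<in> fst ` K" "x \<noteq> 0"
      then show "inverse x \<in> fst ` K" unfolding F using inverse by blast
    qed
    show "fst ` J \<subseteq> fst ` K" using JK by force
    show "field_embedding (fst ` K) \<sigma>"
      unfolding field_embedding_def
    proof (intro conjI ballI)
      show "\<sigma> 1 = 1" by (rule \<sigma>[OF JK[OF cl(2)]])
      fix x y assume "x \<in> fst ` K" "y \<in> fst ` K"
      then obtain v w where vw: "(x, v) \<in> K" "(y, w) \<in> K" unfolding F by blast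
      show "\<sigma> (x + y) = \<sigma> x + \<sigma> y" "\<sigma> (x * y) = \<sigma> x * \<sigma> y"
        by (simp_all only: \<sigma>[OF vw(1)] \<sigma>[OF vw(2)] \<sigma>[OF add[OF vw]] \<sigma>[OF mul[OF vw]])
    qed
    show "\<sigma> a = b" if "(a, b) \<in> J" for a b using \<sigma> JK that by blast
  qed
qed

text \<open>A word in \<open>P0\<close>, \<open>Q0\<close> and the same word in \<open>P\<close>,
  \<open>Q\<close> have coefficients in \<open>lin\<close> that correspond under \<open>J\<close>,
  since the multiplication rules are integral polynomials in the three traces. Hence all traces
  correspond, and the extension of \<open>J\<close> to fields is the embedding.\<close>

lemma galois_conjugate_from_generators:
  assumes G: "group G" "is_rep G \<rho>0" "zariski_dense_rep G \<rho>" "g \<in> carrier G" "h \<in> carrier G"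
    and gen: "carrier G \<subseteq> generate G {g, h}"
    and P: "P0 \<in> \<rho>0 g" "P \<in> \<rho> g" and Q: "Q0 \<in> \<rho>0 h" "Q \<in> \<rho> h"
    and J: "ring_iso_graph J"
    and tr: "(trace P0, trace P) \<in> J" "(trace Q0, trace Q) \<in> J" "(trace (P0 ** Q0), trace (P ** Q)) \<in> J"
  shows "\<exists>\<sigma>. galois_conjugate G \<rho>0 \<sigma> \<rho>"
proof -
  have rep: "is_rep G \<rho>" using G(3) unfolding zariski_dense_rep_def by blast
  have det: "det P0 = 1" "det P = 1" "det Q0 = 1" "det Q = 1"
    using rep_eq_lift[OF G(2)] rep_eq_lift[OF rep] G(4,5) P Q by blast+
  note cl = ring_iso_graph_closed[OF J]
  define \<Phi> where "\<Phi> M0 M \<longleftrightarrow> (\<exists>a b c d a' b' c' d'. (a, a') \<in> J \<and> (b, b') \<in> J \<and> (c, c') \<in> J \<and> (d, d') \<in> J \<and>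
      M0 = lin P0 Q0 a b c d \<and> M = lin P Q a' b' c' d')" for M0 M
  have \<Phi>I: "\<Phi> (lin P0 Q0 a b c d) (lin P Q a' b' c' d')"
    if "(a, a') \<in> J" "(b, b') \<in> J" "(c, c') \<in> J" "(d, d') \<in> J" for a b c d a' b' c' d'
    unfolding \<Phi>_def using that by blast
  have mulP: "\<Phi> (M0 ** P0) (M ** P)" and mulQ: "\<Phi> (M0 ** Q0) (M ** Q)"
    and mulP': "\<Phi> (M0 ** adj2 P0) (M ** adj2 P)" and mulQ': "\<Phi> (M0 ** adj2 Q0) (M ** adj2 Q)"
    if M: "\<Phi> M0 M" for M0 M
  proof -
    obtain a b c d a' b' c' d' where M: "M0 = lin P0 Q0 a b c d" "M = lin P Q a' b' c' d'"
      and m: "(a, a') \<in> J" "(b, b') \<in> J" "(c, c') \<in> J" "(d, d') \<in> J"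
      using M unfolding \<Phi>_def by blast
    show "\<Phi> (M0 ** P0) (M ** P)" "\<Phi> (M0 ** Q0) (M ** Q)"
      "\<Phi> (M0 ** adj2 P0) (M ** adj2 P)" "\<Phi> (M0 ** adj2 Q0) (M ** adj2 Q)"
      unfolding M lin_mult_left_gen[OF det(1,3)] lin_mult_left_gen[OF det(2,4)]
        lin_mult_right_gen[OF det(1,3)] lin_mult_right_gen[OF det(2,4)]
        lin_mult_adj2_left_gen[OF det(1,3)] lin_mult_adj2_left_gen[OF det(2,4)]
        lin_mult_adj2_right_gen[OF det(1,3)] lin_mult_adj2_right_gen[OF det(2,4)]
      by (intro \<Phi>I cl(3-6) m tr)+
  qed
  have smul: "\<Phi> (M0 ** mat t) (M ** mat t')" if MM: "\<Phi> M0 M" and t: "(t, t') \<in> J" for M0 M t t'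
  proof -
    obtain a b c d a' b' c' d' where M: "M0 = lin P0 Q0 a b c d" "M = lin P Q a' b' c' d'"
      and m: "(a, a') \<in> J" "(b, b') \<in> J" "(c, c') \<in> J" "(d, d') \<in> J"
      using MM unfolding \<Phi>_def by blast
    show ?thesis unfolding M lin_mult_mat by (intro \<Phi>I cl(6) m t)
  qed
  have add: "\<Phi> (M0 + N0) (M + N)" if MN: "\<Phi> M0 M" "\<Phi> N0 N" for M0 M N0 N
  proof -
    obtain a b c d a' b' c' d' where M: "M0 = lin P0 Q0 a b c d" "M = lin P Q a' b' c' d'"
      and m: "(a, a') \<in> J" "(b, b') \<in> J" "(c, c') \<in> J" "(d, d') \<in> J"
      using MN(1) unfolding \<Phi>_def by blast
    obtain s t u v s' t' u' v' where N: "N0 = lin P0 Q0 s t u v" "N = lin P Q s' t' u' v'"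
      and n: "(s, s') \<in> J" "(t, t') \<in> J" "(u, u') \<in> J" "(v, v') \<in> J"
      using MN(2) unfolding \<Phi>_def by blast
    show ?thesis unfolding M N lin_add by (intro \<Phi>I cl(4) m n)
  qed
  have mult: "\<Phi> (M0 ** N0) (M ** N)" if M: "\<Phi> M0 M" and N: "\<Phi> N0 N" for M0 M N0 N
  proof -
    obtain a b c d a' b' c' d' where M': "M0 = lin P0 Q0 a b c d" "M = lin P Q a' b' c' d'"
      using M unfolding \<Phi>_def by blast
    obtain s t u v s' t' u' v' where N: "N0 = lin P0 Q0 s t u v" "N = lin P Q s' t' u' v'"
      and n: "(s, s') \<in> J" "(t, t') \<in> J" "(u, u') \<in> J" "(v, v') \<in> J"
      using N unfolding \<Phi>_def by blast
    show ?thesis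
      unfolding N M' lin_mult_lin
      unfolding M'[symmetric] by (intro add smul mulP mulQ n M)
  qed
  have one: "\<Phi> (mat 1) (mat 1)"
    using \<Phi>I[of 1 1 0 0 0 0 0 0] cl(1,2) by (simp add: lin_basis)
  have pair: "\<exists>M0\<in>\<rho>0 k. \<exists>M\<in>\<rho> k. \<Phi> M0 M" if "k \<in> carrier G" for k
    using rep_generate_pair_induct[of G \<rho>0 \<rho> g h P0 P Q0 Q \<Phi> k] G(1,2,4,5) rep gen P Q one mult that
      mulP[OF one] mulQ[OF one] mulP'[OF one] mulQ'[OF one] by simp
  have pairtr: "\<exists>M0\<in>\<rho>0 k. \<exists>M\<in>\<rho> k. (trace M0, trace M) \<in> J" if "k \<in> carrier G" for k
  proof -
    have "(trace M0, trace M) \<in> J" if MM: "\<Phi> M0 M" for M0 M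
    proof -
      obtain a b c d a' b' c' d' where M: "M0 = lin P0 Q0 a b c d" "M = lin P Q a' b' c' d'"
        and m: "(a, a') \<in> J" "(b, b') \<in> J" "(c, c') \<in> J" "(d, d') \<in> J"
        using MM unfolding \<Phi>_def by blast
      show ?thesis
        unfolding M trace_lin mult_2 by (intro cl m tr)
    qed
    then show ?thesis using pair[OF that] by blast
  qed
  obtain F \<sigma> where F: "is_subfield F" "fst ` J \<subseteq> F" "field_embedding F \<sigma>"
    and \<sigma>: "\<And>a b. (a, b) \<in> J \<Longrightarrow> \<sigma> a = b"
    using ring_iso_graph_extends_to_field[OF J] by blast
  \<comment> \<open>The induction reaches one lift of \<open>k\<close>; for the other one both
    traces change sign, which \<open>J\<close> respects.\<close>
  have all: "\<exists>B\<in>\<rho> k. (trace A, trace B) \<in> J" if kA: "k \<in> carrier G" "A \<in> \<rho>0 k" for k A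
  proof -
    obtain M0 M where M: "M0 \<in> \<rho>0 k" "M \<in> \<rho> k" "(trace M0, trace M) \<in> J"
      using pairtr kA(1) by blast
    have "A = M0 \<or> A = - M0" using rep_eq_lift[OF G(2) kA(1) M(1)] kA(2) by blast
    moreover have "- M \<in> \<rho> k" using rep_eq_lift[OF rep kA(1) M(2)] by blast
    ultimately show ?thesis using M cl(3)[OF M(3)] by (metis trace_uminus2)
  qed
  have "trace ` preimage_grp G \<rho>0 \<subseteq> F"
    using all F(2) unfolding preimage_grp_def by force
  then have "trace_field G \<rho>0 \<subseteq> F"
    using F(1) unfolding trace_field_def by blast
  then have "field_embedding (trace_field G \<rho>0) \<sigma>"
    using F(3) unfolding field_embedding_def by blast
  then have "galois_conjugate G \<rho>0 \<sigma> \<rho>"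
    unfolding galois_conjugate_def using G(3) all \<sigma> by metis
  then show ?thesis by blast
qed

lemma conjugate_reps_refl: "conjugate_reps G \<rho> \<rho>"
proof -
  have "matrix_inv (mat 1 :: cmat) = mat 1"
    unfolding matrix_inv_def by (rule some_equality) auto
  then show ?thesis
    unfolding conjugate_reps_def by (intro exI[of _ "mat 1"]) (auto simp: det_I)
qed

lemma galois_rigidI:
  assumes "\<And>\<rho>. zariski_dense_rep G \<rho> \<Longrightarrow> \<exists>\<sigma>. galois_conjugate G \<rho>0 \<sigma> \<rho>"
  shows "galois_rigid G \<rho>0"
  using assms conjugate_reps_refl unfolding galois_rigid_def by blast

subsection \<open>Zariski dense representations of two-generator groups\<close>

lemma lin_left_mult:
  assumes "det P = 1" "det Q = 1"
  shows "P ** lin P Q a b c d = lin P Q (- b) (a + b * trace P) (- d) (c + d * trace P)"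
    and "Q ** lin P Q a b c d =
      lin P Q (b * (trace (P ** Q) - trace P * trace Q) - c - d * trace P) (b * trace Q + d)
        (a + b * trace P + c * trace Q + d * trace (P ** Q)) (- b)"
    and "adj2 P ** lin P Q a b c d = lin P Q (a * trace P + b) (- a) (c * trace P + d) (- c)"
    and "adj2 Q ** lin P Q a b c d =
      lin P Q (a * trace Q - b * (trace (P ** Q) - trace P * trace Q) + c + d * trace P) (- d)
        (- (a + b * trace P + d * trace (P ** Q))) (d * trace Q + b)"
  using assms unfolding lin_def adj2_def mat2_simps
  by (simp_all, (intro conjI; algebra)+)

lemma rep_preimage_span:
  assumes "group G" "is_rep G \<rho>" "g \<in> carrier G" "h \<in> carrier G"
    and gen: "carrier G \<subseteq> generate G {g, h}"
    and PQ: "P \<in> \<rho> g" "Q \<in> \<rho> h" and M: "M \<in> preimage_grp G \<rho>"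
  shows "\<exists>a b c d. M = lin P Q a b c d"
proof -
  have det: "det P = 1" "det Q = 1"
    using rep_eq_lift[OF assms(2)] assms(3,4) PQ by blast+
  show ?thesis
  proof (rule rep_generate_induct[OF assms(1-5) PQ _ _ _ _ _ _ _ M])
    show "\<exists>a b c d. mat 1 = lin P Q a b c d" "\<exists>a b c d. P = lin P Q a b c d"
      "\<exists>a b c d. Q = lin P Q a b c d"
      using lin_basis[of P Q] by metis+
    show "\<exists>a b c d. adj2 P = lin P Q a b c d" "\<exists>a b c d. adj2 Q = lin P Q a b c d"
      using lin_mult_adj2_left_gen[OF det, of 1 0 0 0] lin_mult_adj2_right_gen[OF det, of 1 0 0 0]
      by (simp_all add: lin_basis) blast+
    show "\<exists>a b c d. - M = lin P Q a b c d" if "\<exists>a b c d. M = lin P Q a b c d" for M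
      using that by (elim exE) (simp add: lin_uminus, blast)
    show "\<exists>a b c d. M ** N = lin P Q a b c d"
      if "\<exists>a b c d. M = lin P Q a b c d" "\<exists>a b c d. N = lin P Q a b c d" for M N
      using that by (elim exE) (simp only: lin_mult_lin lin_mult_left_gen[OF det]
          lin_mult_right_gen[OF det] lin_mult_mat lin_add, blast)
  qed
qed

lemma zariski_dense_rep_noncommuting:
  assumes "group G" "zariski_dense_rep G \<rho>" "g \<in> carrier G" "h \<in> carrier G"
    and "carrier G \<subseteq> generate G {g, h}" "P \<in> \<rho> g" "Q \<in> \<rho> h"
  shows "P ** Q \<noteq> Q ** P"
proof -
  have rep: "is_rep G \<rho>" and zd: "zariski_dense_SL2 (preimage_grp G \<rho>)"
    using assms(2) unfolding zariski_dense_rep_def by blast+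
  have det: "det P = 1" "det Q = 1"
    using rep_eq_lift[OF rep] assms by blast+
  show ?thesis
    by (rule zariski_dense_not_commuting_span[OF zd det]) (rule rep_preimage_span[OF assms(1) rep assms(3-7)])
qed

text \<open>Matrices whose conjugation maps \<open>X\<close> into itself are closed under products,
  so stability under the generators and their inverses gives it for the whole image.\<close>

lemma zariski_dense_rep_conj_stable_scalar:
  assumes "group G" "zariski_dense_rep G \<rho>" "g \<in> carrier G" "h \<in> carrier G"
    and "carrier G \<subseteq> generate G {g, h}" "P \<in> \<rho> g" "Q \<in> \<rho> h"
    and X: "finite X"
    and stable: "\<And>M. M \<in> X \<Longrightarrow> P ** M ** adj2 P \<in> X" "\<And>M. M \<in> X \<Longrightarrow> Q ** M ** adj2 Q \<in> X"
      "\<And>M. M \<in> X \<Longrightarrow> adj2 P ** M ** P \<in> X" "\<And>M. M \<in> X \<Longrightarrow> adj2 Q ** M ** Q \<in> X"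
    and M: "M \<in> X"
  shows "M = mat (M$1$1)"
proof -
  have rep: "is_rep G \<rho>" and zd: "zariski_dense_SL2 (preimage_grp G \<rho>)"
    using assms(2) unfolding zariski_dense_rep_def by blast+
  have stab: "\<forall>M\<in>X. k ** M ** adj2 k \<in> X" if "k \<in> preimage_grp G \<rho>" for k
  proof (rule rep_generate_induct[OF assms(1) rep assms(3-7) _ _ _ _ _ _ _ that])
    fix M N assume *: "\<forall>K\<in>X. M ** K ** adj2 M \<in> X" "\<forall>K\<in>X. N ** K ** adj2 N \<in> X"
    show "\<forall>K\<in>X. M ** N ** K ** adj2 (M ** N) \<in> X"
    proof
      fix K assume "K \<in> X"
      then have "M ** (N ** K ** adj2 N) ** adj2 M \<in> X" using * by blast
      then show "M ** N ** K ** adj2 (M ** N) \<in> X"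
        by (simp only: adj2_matrix_mult matrix_mul_assoc)
    qed
  qed (use stable in auto)
  show ?thesis
    by (rule zariski_dense_finite_conj_scalar[OF zd X _ M]) (use stab in blast)
qed

lemma mat_commute: "mat c ** M = (M :: cmat) ** mat c"
  by (simp add: mat2_simps)

text \<open>\<open>A\<close> and \<open>B\<close> act as half turns, so conjugation by either
  inverts \<open>A ** B\<close> and the image would be dihedral.\<close>

lemma zariski_dense_rep_not_order_2:
  assumes "group G" "zariski_dense_rep G \<rho>" "g \<in> carrier G" "h \<in> carrier G"
    and "carrier G \<subseteq> generate G {g, h}" "A \<in> \<rho> g" "B \<in> \<rho> h"
    and tr: "trace A = 0" "trace B = 0"
  shows False
proof -
  have rep: "is_rep G \<rho>" using assms(2) unfolding zariski_dense_rep_def by blast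
  have det: "det A = 1" "det B = 1"
    using rep_eq_lift[OF rep] assms by blast+
  define w where "w = trace (A ** B)"
  \<comment> \<open>\<open>A ** B\<close> and its inverse \<open>mat w - A ** B\<close>.\<close>
  let ?X = "{lin A B 0 0 0 1, lin A B w 0 0 (-1)}"
  have "lin A B 0 0 0 1 = mat (lin A B 0 0 0 1 $1$1)"
    by (rule zariski_dense_rep_conj_stable_scalar[OF assms(1-7), of ?X])
       (auto simp: lin_left_mult[OF det] lin_mult_left_gen[OF det] lin_mult_right_gen[OF det]
         lin_mult_adj2_left_gen[OF det] lin_mult_adj2_right_gen[OF det] tr w_def[symmetric])
  then obtain c where c: "A ** B = mat c" by (metis lin_basis(4))
  have "B ** A = adj2 A ** A ** B ** A"
    by (simp add: adj2_mult[OF det(1)])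
  also have "\<dots> = adj2 A ** (mat c ** A)"
    by (simp only: c[symmetric] matrix_mul_assoc)
  also have "\<dots> = mat c"
    by (simp only: mat_commute[of c A] matrix_mul_assoc adj2_mult[OF det(1)] matrix_mul_lid)
  finally show False
    using zariski_dense_rep_noncommuting[OF assms(1-7)] c by simp
qed

text \<open>Here \<open>A B\<inverse>\<close> and its conjugates by \<open>A\<close> generate a quaternion group normalised by \<open>A\<close>
  and \<open>B\<close>, so that the image would be a binary tetrahedral group.\<close>
lemma zariski_dense_rep_not_order_3:
  assumes "group G" "zariski_dense_rep G \<rho>" "g \<in> carrier G" "h \<in> carrier G"
    and "carrier G \<subseteq> generate G {g, h}" "A \<in> \<rho> g" "B \<in> \<rho> h"
    and tr: "trace A = x" "trace B = x" "x^2 = 1" "trace (A ** adj2 B) = 0"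
  shows False
proof -
  have rep: "is_rep G \<rho>" using assms(2) unfolding zariski_dense_rep_def by blast
  have det: "det A = 1" "det B = 1"
    using rep_eq_lift[OF rep] assms by blast+
  have xx: "x * x = 1" using tr(3) by (simp add: power2_eq_square)
  have w: "trace (A ** B) = 1"
    using trace_mult_adj2[of A B] tr xx by simp
  \<comment> \<open>The six elements of order 4 of that quaternion group: \<open>?c\<close> is
    \<open>A ** adj2 B\<close>, \<open>?e\<close> is \<open>- (adj2 A ** B)\<close>, and the primed
    matrices are the negatives.\<close>
  let ?c = "lin A B 0 x 0 (-1)" and ?d = "lin A B (-1) x x 0" and ?e = "lin A B 0 0 (-x) 1"
  let ?c' = "lin A B 0 (-x) 0 1" and ?d' = "lin A B 1 (-x) (-x) 0" and ?e' = "lin A B 0 0 x (-1)"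
  let ?X = "{?c, ?d, ?e, ?c', ?d', ?e'}"
  have "?c = mat (?c $1$1)"
    by (rule zariski_dense_rep_conj_stable_scalar[OF assms(1-7), of ?X])
       (auto simp: lin_left_mult[OF det] lin_mult_left_gen[OF det] lin_mult_right_gen[OF det]
         lin_mult_adj2_left_gen[OF det] lin_mult_adj2_right_gen[OF det] tr w xx)
  moreover have "A ** adj2 B = ?c"
    using lin_mult_adj2_right_gen[OF det, of 0 1 0 0] by (simp add: lin_basis tr)
  ultimately obtain c where c: "A ** adj2 B = mat c" by metis
  have "A ** adj2 B ** B = mat c ** B" by (simp only: c)
  then have "A = mat c ** B"
    by (simp add: matrix_mul_assoc[symmetric] adj2_mult[OF det(2)])
  then have "A ** B = B ** A"
    by (simp only: matrix_mul_assoc mat_commute[of c B, symmetric])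
  then show False
    using zariski_dense_rep_noncommuting[OF assms(1-7)] by simp
qed

subsection \<open>Quotients of the figure-eight knot group\<close>

primrec mat_pow :: "cmat \<Rightarrow> nat \<Rightarrow> cmat" where
  "mat_pow A 0 = mat 1"
| "mat_pow A (Suc k) = mat_pow A k ** A"

text \<open>\<open>cheb k (2 cos \<theta>) = sin (k \<theta>) / sin \<theta>\<close>, a Chebyshev polynomial of the second kind.\<close>
fun cheb :: "nat \<Rightarrow> complex \<Rightarrow> complex" where
  "cheb 0 x = 0"
| "cheb (Suc 0) x = 1"
| "cheb (Suc (Suc k)) x = x * cheb (Suc k) x - cheb k x"

lemma mat_pow_cheb:
  assumes "det A = 1"
  shows "mat_pow A (Suc k) = mat (cheb (Suc k) (trace A)) ** A - mat (cheb k (trace A))"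
proof (induction k)
  case 0
  show ?case by (simp add: mat2_simps)
next
  case (Suc k)
  have "(mat u ** A - mat v) ** A = mat (trace A * u - v) ** A - mat u" for u v
    using assms unfolding mat2_simps by (simp, intro conjI; ((simp add: algebra_simps; fail) | algebra))
  then show ?case using Suc by simp
qed

lemma rep_mat_pow:
  assumes "group G" "is_rep G \<rho>" "g \<in> carrier G" "A \<in> \<rho> g"
  shows "mat_pow A k \<in> \<rho> (g [^]\<^bsub>G\<^esub> k)"
proof (induction k)
  case 0
  then show ?case using rep_one[OF assms(1,2)] by simp
next
  case (Suc k)
  interpret group G by fact
  show ?case using rep_mult[OF assms(2) _ assms(3) Suc assms(4)] assms(3) by simp
qed

lemma scalar_if_mat_smult_scalar:
  assumes "mat u ** A = (mat v :: cmat)" "u \<noteq> 0"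
  shows "A = mat (A$1$1)"
  using assms by (auto simp: mat2_simps)

text \<open>The power is \<open>cheb (Suc k) (trace A)\<close> times \<open>A\<close> minus a
  scalar. If it is plus or minus the identity and this coefficient is nonzero, then \<open>A\<close>
  itself is scalar.\<close>

lemma cheb_zero_if_pow_one:
  assumes "group G" "is_rep G \<rho>" "g \<in> carrier G" "A \<in> \<rho> g"
    and "g [^]\<^bsub>G\<^esub> Suc k = \<one>\<^bsub>G\<^esub>" "A \<noteq> mat (A$1$1)"
  shows "cheb (Suc k) (trace A) = 0"
proof (rule ccontr)
  assume ne: "cheb (Suc k) (trace A) \<noteq> 0"
  have det: "det A = 1" using rep_eq_lift[OF assms(2-4)] by blast
  have "mat_pow A (Suc k) \<in> {mat 1, - mat 1}"
    using rep_mat_pow[OF assms(1-4), of "Suc k"] assms(5) rep_one[OF assms(1,2)] by simp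
  then have "mat (cheb (Suc k) (trace A)) ** A - mat (cheb k (trace A)) \<in> {mat 1, - mat 1}"
    unfolding mat_pow_cheb[OF det] .
  moreover have "M = (mat (1 + v) :: cmat)" if "M - mat v = mat 1" for M v
    using that by (simp add: mat2_simps algebra_simps)
  moreover have "M = (mat (v - 1) :: cmat)" if "M - mat v = - mat 1" for M v
    using that by (simp add: mat2_simps algebra_simps)
  ultimately obtain v where "mat (cheb (Suc k) (trace A)) ** A = mat v"
    by blast
  then show False using scalar_if_mat_smult_scalar ne assms(6) by blast
qed

text \<open>Here the power is a scalar matrix of determinant 1, hence a lift of the identity, and
  faithfulness applies. Together with \<open>cheb_zero_if_pow_one\<close> this carries trace
  equations from a faithful representation to any other.\<close>

lemma pow_one_if_cheb_zero:
  assumes "group G" "is_rep G \<rho>" "inj_on \<rho> (carrier G)" "g \<in> carrier G" "A \<in> \<rho> g"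
    and "cheb (Suc k) (trace A) = 0"
  shows "g [^]\<^bsub>G\<^esub> Suc k = \<one>\<^bsub>G\<^esub>"
proof -
  interpret group G by fact
  have det: "det A = 1" using rep_eq_lift[OF assms(2,4,5)] by blast
  define c where "c = - cheb k (trace A)"
  have pow: "mat_pow A (Suc k) = mat c"
    unfolding mat_pow_cheb[OF det] assms(6) c_def by (simp add: mat2_simps)
  have mem: "mat_pow A (Suc k) \<in> \<rho> (g [^]\<^bsub>G\<^esub> Suc k)"
    by (rule rep_mat_pow[OF assms(1,2,4,5)])
  then have "det (mat c :: cmat) = 1"
    using rep_eq_lift(2)[OF assms(2) _ mem] pow assms(4) by simp
  then have "c = 1 \<or> c = -1"
    by (simp add: det_2 mat_def power2_eq_square[symmetric] power2_eq_1_iff)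
  then have "mat c = (mat 1 :: cmat) \<or> mat c = (- mat 1 :: cmat)"
    by (auto simp: mat2_simps)
  then have "mat c \<in> \<rho> \<one>\<^bsub>G\<^esub>"
    unfolding rep_one[OF assms(1,2)] by blast
  then show ?thesis
    using rep_eq_if_common_lift[OF assms(2,3) _ _ mem] pow assms(4) by simp
qed

text \<open>The relation lifts only up to sign. The word \<open>W\<close> contains \<open>B\<close>
  and its inverse once each and so ignores the sign of \<open>B\<close>, while \<open>B ** W\<close>
  does not; the sign of \<open>B\<close> is chosen to make the relation exact. Then \<open>B\<close>
  is conjugate to \<open>A\<close>, and \<open>fig8_matrix_identity\<close> turns the relation into
  \<open>r * (A - B) = 0\<close>.\<close>

lemma fig8_rep_lifts:
  assumes "group G" "is_rep G \<rho>" "g \<in> carrier G" "h \<in> carrier G" "A \<in> \<rho> g"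
    and rel: "g \<otimes>\<^bsub>G\<^esub> inv\<^bsub>G\<^esub> h \<otimes>\<^bsub>G\<^esub> inv\<^bsub>G\<^esub> g \<otimes>\<^bsub>G\<^esub> h \<otimes>\<^bsub>G\<^esub> g =
      h \<otimes>\<^bsub>G\<^esub> (g \<otimes>\<^bsub>G\<^esub> inv\<^bsub>G\<^esub> h \<otimes>\<^bsub>G\<^esub> inv\<^bsub>G\<^esub> g \<otimes>\<^bsub>G\<^esub> h)"
  obtains B z where "B \<in> \<rho> h" "trace B = trace A" "trace (A ** adj2 B) = z"
    "A = B \<or> z^2 - ((trace A)^2 - 1) * z + ((trace A)^2 - 1) = 0"
proof -
  interpret group G by fact
  have detA: "det A = 1" using rep_eq_lift[OF assms(2,3,5)] by blast
  obtain B1 where B1: "B1 \<in> \<rho> h" "det B1 = 1" "\<rho> h = {B1, - B1}"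
    using rep_lift[OF assms(2,4)] by (metis insertI1)
  define W where "W = A ** adj2 B1 ** adj2 A ** B1"
  let ?w = "g \<otimes>\<^bsub>G\<^esub> inv\<^bsub>G\<^esub> h \<otimes>\<^bsub>G\<^esub> inv\<^bsub>G\<^esub> g \<otimes>\<^bsub>G\<^esub> h"
  have w: "?w \<in> carrier G" using assms(3,4) by simp
  have W: "W \<in> \<rho> ?w"
    unfolding W_def using assms(3,4)
    by (intro rep_mult[OF assms(2)] rep_inv[OF assms(1,2)] assms(5) B1(1)) auto
  have "W ** A \<in> \<rho> (?w \<otimes>\<^bsub>G\<^esub> g)" "B1 ** W \<in> \<rho> (h \<otimes>\<^bsub>G\<^esub> ?w)"
    using rep_mult[OF assms(2) w assms(3) W assms(5)] rep_mult[OF assms(2) assms(4) w B1(1) W] by blast+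
  then have "W ** A = B1 ** W \<or> W ** A = - (B1 ** W)"
    unfolding rel using rep_eq_lift(1)[OF assms(2), of "h \<otimes>\<^bsub>G\<^esub> ?w" "B1 ** W"] w assms(4) by auto
  then have "W ** A = B1 ** W \<or> W ** A = (- B1) ** W"
    by (simp only: mult_uminus2)
  then obtain B where B: "B = B1 \<or> B = - B1" and BW: "W ** A = B ** W"
    by blast
  have BW': "W = A ** adj2 B ** adj2 A ** B"
    using B by (elim disjE) (simp_all only: W_def adj2_uminus mult_uminus2 minus_minus)
  have Bh: "B \<in> \<rho> h" using B B1(3) by blast
  have detB: "det B = 1" using rep_eq_lift[OF assms(2,4) Bh] by blast
  have detW: "det W = 1" using rep_eq_lift[OF assms(2) w W] by blast
  have "B = W ** A ** adj2 W"
    unfolding BW by (simp add: matrix_mul_assoc[symmetric] adj2_mult[OF detW])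
  then have "trace B = trace (adj2 W ** (W ** A))"
    by (metis trace_mul_sym)
  then have tr: "trace B = trace A"
    by (simp add: matrix_mul_assoc adj2_mult[OF detW])
  define x where "x = trace A"
  define z where "z = trace (A ** adj2 B)"
  define r where "r = z^2 - (x^2 - 1) * z + (x^2 - 1)"
  have "W ** A - B ** W = lin A B 0 r (- r) 0"
    using fig8_matrix_identity[OF detA detB x_def[symmetric] tr[folded x_def] z_def[symmetric], folded r_def]
    unfolding BW' matrix_mul_assoc .
  then have 0: "lin A B 0 r (- r) 0 = 0" unfolding BW by simp
  have "A = B \<or> r = 0"
  proof (rule disjCI)
    assume "r \<noteq> 0"
    then show "A = B" using 0 by (simp add: lin_def vec_eq_iff)
  qed
  then show ?thesis
    using that[OF Bh tr z_def[symmetric]] unfolding r_def x_def by blast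
qed

text \<open>\<open>T\<close> contains every admissible trace of a lift of \<open>g\<close> up to
  sign, and \<open>iso\<close> says that the pairs \<open>(x, z)\<close> over \<open>T\<close>
  generate isomorphic rings. It remains to bring both representations into this situation; the
  nondegeneracy of \<open>\<rho>0\<close> comes from that of \<open>\<rho>\<close> by
  faithfulness.\<close>

lemma fig8_quotient_galois_conjugate:
  assumes G: "group G" "g \<in> carrier G" "h \<in> carrier G" "carrier G \<subseteq> generate G {g, h}"
    and rel: "g \<otimes>\<^bsub>G\<^esub> inv\<^bsub>G\<^esub> h \<otimes>\<^bsub>G\<^esub> inv\<^bsub>G\<^esub> g \<otimes>\<^bsub>G\<^esub> h \<otimes>\<^bsub>G\<^esub> g =
      h \<otimes>\<^bsub>G\<^esub> (g \<otimes>\<^bsub>G\<^esub> inv\<^bsub>G\<^esub> h \<otimes>\<^bsub>G\<^esub> inv\<^bsub>G\<^esub> g \<otimes>\<^bsub>G\<^esub> h)"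
    and pow: "g [^]\<^bsub>G\<^esub> n = \<one>\<^bsub>G\<^esub>" "n > 0"
    and \<rho>0: "is_rep G \<rho>0" "inj_on \<rho>0 (carrier G)" and \<rho>: "zariski_dense_rep G \<rho>"
    and T: "\<And>x. cheb n x = 0 \<Longrightarrow> x \<noteq> 0 \<Longrightarrow> x^2 \<noteq> 1 \<Longrightarrow> x \<in> T \<or> - x \<in> T"
    and iso: "\<And>x0 z0 x z. x0 \<in> T \<Longrightarrow> x \<in> T \<Longrightarrow> z0^2 - (x0^2 - 1) * z0 + (x0^2 - 1) = 0 \<Longrightarrow>
      z^2 - (x^2 - 1) * z + (x^2 - 1) = 0 \<Longrightarrow> \<exists>J. ring_iso_graph J \<and> (x0, x) \<in> J \<and> (z0, z) \<in> J"
  shows "\<exists>\<sigma>. galois_conjugate G \<rho>0 \<sigma> \<rho>"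
proof -
  interpret group G by fact
  have rep: "is_rep G \<rho>" using \<rho> unfolding zariski_dense_rep_def by blast
  obtain m where n: "n = Suc m" using pow(2) by (cases n) auto
  have noncomm: "A ** B \<noteq> B ** A" if "A \<in> \<rho> g" "B \<in> \<rho> h" for A B
    using zariski_dense_rep_noncommuting[OF G(1) \<rho> G(2-4) that] .
  obtain A1 B1 where AB1: "A1 \<in> \<rho> g" "B1 \<in> \<rho> h"
    using rep_lift[OF rep G(2)] rep_lift[OF rep G(3)] by (metis insertI1)
  have nonscalar: "A \<noteq> mat (A$1$1)" if "A \<in> \<rho> g" for A
    using noncomm[OF that AB1(2)] mat_commute by metis
  have gh: "g \<noteq> h"
    using noncomm[OF AB1(1), of A1] AB1 by auto
  have lift: "\<exists>B z. B \<in> \<rho> h \<and> trace B = trace A \<and> trace (A ** adj2 B) = z \<and>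
      z^2 - ((trace A)^2 - 1) * z + ((trace A)^2 - 1) = 0" if A: "A \<in> \<rho> g" for A
    by (rule fig8_rep_lifts[OF G(1) rep G(2,3) A rel]) (use noncomm[OF A] in metis)
  have low: "trace A \<noteq> 0" "(trace A)^2 \<noteq> 1" if A: "A \<in> \<rho> g" for A
  proof -
    obtain B z where B: "B \<in> \<rho> h" "trace B = trace A" "trace (A ** adj2 B) = z"
      "z^2 - ((trace A)^2 - 1) * z + ((trace A)^2 - 1) = 0"
      using lift[OF A] by blast
    show "trace A \<noteq> 0"
      using zariski_dense_rep_not_order_2[OF G(1) \<rho> G(2-4) A B(1)] B(2) by auto
    show "(trace A)^2 \<noteq> 1"
    proof
      assume 1: "(trace A)^2 = 1"
      then have "z = 0" using B(4) by simp
      then show False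
        using zariski_dense_rep_not_order_3[OF G(1) \<rho> G(2-4) A B(1) HOL.refl B(2) 1] B(3) by simp
    qed
  qed
  \<comment> \<open>By faithfulness of \<open>\<rho>0\<close> a zero of \<open>cheb\<close> at
    \<open>trace A0\<close> makes a power of \<open>g\<close> trivial, which is visible under
    \<open>\<rho>\<close> too.\<close>
  have cheb0: "cheb (Suc k) (trace A) = 0" if "A0 \<in> \<rho>0 g" "A \<in> \<rho> g" "cheb (Suc k) (trace A0) = 0" for A0 A k
    using cheb_zero_if_pow_one[OF G(1) rep G(2) that(2) _ nonscalar[OF that(2)]]
      pow_one_if_cheb_zero[OF G(1) \<rho>0 G(2) that(1) that(3)] by blast
  \<comment> \<open>A scalar lift would make \<open>g\<close> trivial, and then the lifts of
    \<open>g\<close> under \<open>\<rho>\<close> would be central.\<close>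
  have nonscalar0: "A0 \<noteq> mat (A0$1$1)" if A0: "A0 \<in> \<rho>0 g" for A0
  proof
    assume s: "A0 = mat (A0$1$1)"
    have "det A0 = 1" using rep_eq_lift[OF \<rho>0(1) G(2) A0] by blast
    then have "det (mat (A0$1$1) :: cmat) = 1" using s by metis
    then have "A0$1$1 = 1 \<or> A0$1$1 = -1"
      by (simp add: det_2 mat_def power2_eq_square[symmetric] power2_eq_1_iff)
    moreover have "mat (-1) = (- mat 1 :: cmat)" by (simp add: mat2_simps)
    ultimately have "A0 \<in> \<rho>0 \<one>\<^bsub>G\<^esub>"
      unfolding rep_one[OF G(1) \<rho>0(1)] using s by (metis insertI1 insertI2)
    then have "g = \<one>\<^bsub>G\<^esub>" using rep_eq_if_common_lift[OF \<rho>0 G(2) one_closed A0] by blast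
    then have "A1 = mat 1 \<or> A1 = - mat 1" using AB1(1) rep_one[OF G(1) rep] by simp
    then have "A1 ** B1 = B1 ** A1" by (elim disjE) simp_all
    then show False using noncomm AB1 by blast
  qed
  \<comment> \<open>\<open>cheb 2 x = x\<close> and \<open>cheb 3 x = x^2 - 1\<close>, so
    \<open>low\<close> excludes orders 2 and 3 for \<open>g\<close>.\<close>
  have low0: "trace A0 \<noteq> 0" "(trace A0)^2 \<noteq> 1" if A0: "A0 \<in> \<rho>0 g" for A0
  proof -
    show "trace A0 \<noteq> 0"
      using cheb0[OF A0 AB1(1), of 1] low(1)[OF AB1(1)] by (auto simp: numeral_eq_Suc)
    show "(trace A0)^2 \<noteq> 1"
      using cheb0[OF A0 AB1(1), of 2] low(2)[OF AB1(1)] by (auto simp: numeral_eq_Suc)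
  qed
  obtain A where A: "A \<in> \<rho> g" "trace A \<in> T"
  proof -
    have "cheb n (trace A1) = 0"
      using cheb_zero_if_pow_one[OF G(1) rep G(2) AB1(1) _ nonscalar[OF AB1(1)]] pow(1) n by blast
    then have "trace A1 \<in> T \<or> trace (- A1) \<in> T" using T low[OF AB1(1)] by simp
    moreover have "- A1 \<in> \<rho> g" using rep_eq_lift(1)[OF rep G(2) AB1(1)] by blast
    ultimately show ?thesis using that AB1(1) by blast
  qed
  obtain A0 where A0: "A0 \<in> \<rho>0 g" "trace A0 \<in> T"
  proof -
    obtain A2 where A2: "A2 \<in> \<rho>0 g" using rep_lift[OF \<rho>0(1) G(2)] by (metis insertI1)
    have "cheb n (trace A2) = 0"
      using cheb_zero_if_pow_one[OF G(1) \<rho>0(1) G(2) A2 _ nonscalar0[OF A2]] pow(1) n by blast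
    then have "trace A2 \<in> T \<or> trace (- A2) \<in> T" using T low0[OF A2] by simp
    moreover have "- A2 \<in> \<rho>0 g" using rep_eq_lift(1)[OF \<rho>0(1) G(2) A2] by blast
    ultimately show ?thesis using that A2 by blast
  qed
  obtain B z where B: "B \<in> \<rho> h" "trace B = trace A" "trace (A ** adj2 B) = z"
      "z^2 - ((trace A)^2 - 1) * z + ((trace A)^2 - 1) = 0"
    using lift[OF A(1)] by blast
  obtain B0 z0 where B0: "B0 \<in> \<rho>0 h" "trace B0 = trace A0" "trace (A0 ** adj2 B0) = z0"
      "A0 = B0 \<or> z0^2 - ((trace A0)^2 - 1) * z0 + ((trace A0)^2 - 1) = 0"
    by (rule fig8_rep_lifts[OF G(1) \<rho>0(1) G(2,3) A0(1) rel])
  have "A0 \<noteq> B0"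
    using rep_eq_if_common_lift[OF \<rho>0 G(2,3) A0(1)] B0(1) gh by blast
  then have z0: "z0^2 - ((trace A0)^2 - 1) * z0 + ((trace A0)^2 - 1) = 0"
    using B0(4) by blast
  obtain J where J: "ring_iso_graph J" "(trace A0, trace A) \<in> J" "(z0, z) \<in> J"
    using iso[OF A0(2) A(2) z0 B(4)] by blast
  have "trace (A ** B) = trace A * trace A - z" "trace (A0 ** B0) = trace A0 * trace A0 - z0"
    using trace_mult_adj2[of A B] trace_mult_adj2[of A0 B0] B(2,3) B0(2,3) by simp_all
  then have "(trace (A0 ** B0), trace (A ** B)) \<in> J"
    by (simp only:) (intro ring_iso_graph_closed[OF J(1)] J)
  then show ?thesis
    using galois_conjugate_from_generators[OF G(1) \<rho>0(1) \<rho> G(2-4) A0(1) A(1) B0(1) B(1) J(1,2)]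
      B(2) B0(2) J(2) by simp
qed

subsection \<open>The Fibonacci group F(2,8)\<close>

fun fib_seq :: "cmat \<Rightarrow> cmat \<Rightarrow> nat \<Rightarrow> cmat" where
  "fib_seq P Q 0 = P"
| "fib_seq P Q (Suc 0) = Q"
| "fib_seq P Q (Suc (Suc k)) = fib_seq P Q (Suc k) ** fib_seq P Q k"

text \<open>The products contain 13 factors \<open>P\<close> and 21 factors \<open>Q\<close> at
  index 8, and 21 and 34 at index 9; only the parities count.\<close>

lemma fib_seq_uminus:
  "fib_seq (- P) Q 8 = - fib_seq P Q 8" "fib_seq (- P) Q 9 = - fib_seq P Q 9"
  "fib_seq P (- Q) 8 = - fib_seq P Q 8" "fib_seq P (- Q) 9 = fib_seq P Q 9"
  by (simp_all add: eval_nat_numeral)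

text \<open>Lifting the recursion leaves possible sign errors at indices 8 and 9. Replacing
  \<open>P\<close> by \<open>- P\<close> flips only the second, replacing \<open>Q\<close> by
  \<open>- Q\<close> flips both, so all four patterns can be corrected.\<close>

lemma fib_rep_lifts:
  assumes "group G" "is_rep G \<rho>" "\<And>j. f j \<in> carrier G"
    and rec: "\<And>j. f (Suc (Suc j)) = f (Suc j) \<otimes>\<^bsub>G\<^esub> f j" and per: "f 8 = f 0" "f 9 = f 1"
  obtains X where "\<And>j. X j \<in> \<rho> (f j)" "\<And>j. X (Suc (Suc j)) = X (Suc j) ** X j"
    "\<And>j. X (j + 8) = X j"
proof -
  have mem: "fib_seq P Q j \<in> \<rho> (f j)" if "P \<in> \<rho> (f 0)" "Q \<in> \<rho> (f 1)" for P Q j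
    using that by (induction P Q j rule: fib_seq.induct) (auto simp: rec intro!: rep_mult[OF assms(2,3,3)])
  obtain P Q where PQ: "P \<in> \<rho> (f 0)" "Q \<in> \<rho> (f 1)"
    using rep_lift[OF assms(2,3)] by (metis insertI1)
  have neg: "- P \<in> \<rho> (f 0)" "- Q \<in> \<rho> (f 1)"
    using rep_eq_lift(1)[OF assms(2,3)] PQ by blast+
  have 8: "fib_seq P Q 8 = P \<or> fib_seq P Q 8 = - P"
    using mem[OF PQ, of 8] rep_eq_lift(1)[OF assms(2,3) PQ(1)] per by simp
  have 9: "fib_seq P Q 9 = Q \<or> fib_seq P Q 9 = - Q"
    using mem[OF PQ, of 9] rep_eq_lift(1)[OF assms(2,3) PQ(2)] per by simp
  have "\<exists>P' Q'. P' \<in> \<rho> (f 0) \<and> Q' \<in> \<rho> (f 1) \<and> fib_seq P' Q' 8 = P' \<and> fib_seq P' Q' 9 = Q'"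
  proof -
    consider "fib_seq P Q 8 = P" "fib_seq P Q 9 = Q" | "fib_seq P Q 8 = - P" "fib_seq P Q 9 = Q"
      | "fib_seq P Q 8 = P" "fib_seq P Q 9 = - Q" | "fib_seq P Q 8 = - P" "fib_seq P Q 9 = - Q"
      using 8 9 by blast
    then show ?thesis
    proof cases
      case 1
      then show ?thesis using PQ by blast
    next
      case 2
      then have "fib_seq (- P) (- Q) 8 = - P" "fib_seq (- P) (- Q) 9 = - Q"
        by (simp_all only: fib_seq_uminus minus_minus)
      then show ?thesis using neg by blast
    next
      case 3
      then have "fib_seq (- P) Q 8 = - P" "fib_seq (- P) Q 9 = Q"
        by (simp_all only: fib_seq_uminus minus_minus)
      then show ?thesis using neg(1) PQ(2) by blast
    next
      case 4
      then have "fib_seq P (- Q) 8 = P" "fib_seq P (- Q) 9 = - Q"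
        by (simp_all only: fib_seq_uminus minus_minus)
      then show ?thesis using neg(2) PQ(1) by blast
    qed
  qed
  then obtain P' Q' where PQ': "P' \<in> \<rho> (f 0)" "Q' \<in> \<rho> (f 1)" "fib_seq P' Q' 8 = P'" "fib_seq P' Q' 9 = Q'"
    by blast
  have "fib_seq P' Q' (j + 8) = fib_seq P' Q' j \<and> fib_seq P' Q' (Suc j + 8) = fib_seq P' Q' (Suc j)" for j
  proof (induction j)
    case 0
    then show ?case using PQ'(3,4) by simp
  next
    case (Suc j)
    have "fib_seq P' Q' (Suc (Suc j) + 8) = fib_seq P' Q' (Suc j + 8) ** fib_seq P' Q' (j + 8)"
      by (simp only: add_Suc fib_seq.simps)
    then show ?case using Suc by simp
  qed
  then show ?thesis
    using that[of "fib_seq P' Q'"] mem[OF PQ'(1,2)] by auto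
qed

section \<open>The linearised recursion and its traces\<close>

lemma mat_mult_entry: "(mat t ** (M :: cmat)) $ k $ l = t * M $ k $ l"
  using exhaust_2[of k] by (auto simp: matrix_matrix_mult_def sum_2 mat_def)

text \<open>Since \<open>QP + (QP)^-1 = tr (QP)\<close>, the left side is
  \<open>tr (QP) Q - P^-1\<close>, and \<open>P^-1 = tr P - P\<close>. This makes the Fibonacci
  recursion linear with traces as coefficients.\<close>

lemma fib_trace_step:
  fixes P Q :: cmat
  assumes "det P = 1" "det Q = 1"
  shows "(Q ** P) ** Q = mat (trace (Q ** P)) ** Q + P - mat (trace P)"
  using assms unfolding mat2_simps by (simp, intro conjI; ((simp add: algebra_simps; fail) | algebra))

lemma trace_commutator_mult:
  fixes P Q :: cmat
  shows "trace ((P ** Q - Q ** P) ** (mat a ** (Q ** P) + mat b ** Q + mat c ** P + mat d)) =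
    a * det (P ** Q - Q ** P)"
  unfolding mat2_simps by simp algebra

text \<open>In the trace pairing the commutator is orthogonal to \<open>1\<close>, \<open>P\<close>,
  \<open>Q\<close> and pairs with \<open>Q ** P\<close> to its determinant, which isolates
  \<open>a\<close>. Taking commutators of what is left with \<open>P\<close> and with
  \<open>Q\<close> isolates \<open>b\<close> and \<open>c\<close>.\<close>

lemma lin_indep_if_det_commutator:
  fixes P Q :: cmat
  assumes E: "mat a ** (Q ** P) + mat b ** Q + mat c ** P + mat d = 0"
    and D: "det (P ** Q - Q ** P) \<noteq> 0"
  shows "a = 0" "b = 0" "c = 0"
proof -
  have "a * det (P ** Q - Q ** P) = 0"
    unfolding trace_commutator_mult[of P Q a b c d, symmetric] E by (simp add: mat2_simps)
  then show a: "a = 0" using D by simp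
  define D' where "D' = P ** Q - Q ** P"
  have D'0: "t = 0" if "mat t ** D' = 0" for t
  proof (rule ccontr)
    assume "t \<noteq> 0"
    then have "D' = 0" using that by (simp add: mat2_simps)
    then show False using D unfolding D'_def by (simp add: det_2)
  qed
  have E': "mat b ** Q + mat c ** P + mat d = 0"
    using E unfolding a by (simp add: mat2_simps)
  have "mat b ** D' = P ** (mat b ** Q + mat c ** P + mat d) - (mat b ** Q + mat c ** P + mat d) ** P"
    unfolding D'_def by (simp add: mat2_simps algebra_simps)
  then show "b = 0" using D'0 unfolding E' by simp
  have "mat (- c) ** D' = Q ** (mat b ** Q + mat c ** P + mat d) - (mat b ** Q + mat c ** P + mat d) ** Q"
    unfolding D'_def by (simp add: mat2_simps algebra_simps)
  then show "c = 0" using D'0[of "- c"] unfolding E' by simp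
qed

text \<open>The relation \<open>X\<^sub>8 = X\<^sub>0\<close> is a linear dependence between \<open>1, X\<^sub>3, X\<^sub>4, X\<^sub>5\<close>; all its
  coefficients vanish when \<open>X\<^sub>3, X\<^sub>4\<close> generate an irreducible group.\<close>
lemma fib8_traces:
  assumes det: "\<And>j. det (X j) = 1" and rec: "\<And>j. X (Suc (Suc j)) = X (Suc j) ** (X j :: cmat)"
    and per: "\<And>j. X (j + 8) = X j"
    and D: "det (X 0 ** X 1 - X 1 ** X 0) \<noteq> 0"
  shows "trace (X 0) = 1 - trace (X 1)" "trace (X 0 ** X 1) = 1 - trace (X 1)"
    "(trace (X 1))^2 - trace (X 1) + 1 = 0"
proof -
  define t where "t j = trace (X j)" for j
  \<comment> \<open>Consecutive commutators differ by a factor of determinant 1 and a sign.\<close>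
  have Dj: "det (X j ** X (Suc j) - X (Suc j) ** X j) \<noteq> 0" for j
  proof (induction j)
    case 0
    then show ?case using D by simp
  next
    case (Suc j)
    have "X (Suc j) ** X (Suc (Suc j)) - X (Suc (Suc j)) ** X (Suc j) =
      X (Suc j) ** (X (Suc j) ** X j - X j ** X (Suc j))"
      unfolding rec by (simp add: mat2_simps algebra_simps)
    then have "det (X (Suc j) ** X (Suc (Suc j)) - X (Suc (Suc j)) ** X (Suc j)) =
       det (X (Suc j) ** X j - X j ** X (Suc j))"
      by (simp add: det_mul det)
    also have "\<dots> = det (X j ** X (Suc j) - X (Suc j) ** X j)"
      by (simp add: det_2 algebra_simps)
    finally show ?case using Suc by simp
  qed
  have step: "X (j + 3) = mat (t (j + 2)) ** X (j + 1) + X j - mat (t j)" for j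
    using fib_trace_step[OF det[of j] det[of "Suc j"]] rec[of j] rec[of "Suc j"]
    unfolding t_def by (simp add: numeral_eq_Suc)
  \<comment> \<open>Eliminate \<open>X i\<close>, \<open>X (i+1)\<close>, \<open>X (i+2)\<close> and
    \<open>X (i+6)\<close> from the five relations \<open>s\<close>; the last of them uses
    \<open>X (i+8) = X i\<close>.\<close>
  have dep: "mat (1 - t (i+2) * t (i+3)) ** X (i+5) + mat (t (i+7) * t (i+5) + t (i+2)) ** X (i+4)
     + mat (t (i+7) - 1 + t (i+2) * t (i+3) * t (i+4)) ** X (i+3) + mat (t (i+2) * t (i+1) - t i - t (i+2) * t (i+3) * t (i+2)
     - t (i+7) * t (i+3) - t (i+5)) = 0" for i
  proof -
    have s: "X (i+3) = mat (t (i+2)) ** X (i+1) + X i - mat (t i)"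
      "X (i+4) = mat (t (i+3)) ** X (i+2) + X (i+1) - mat (t (i+1))"
      "X (i+5) = mat (t (i+4)) ** X (i+3) + X (i+2) - mat (t (i+2))"
      "X (i+6) = mat (t (i+5)) ** X (i+4) + X (i+3) - mat (t (i+3))"
      "X i = mat (t (i+7)) ** X (i+6) + X (i+5) - mat (t (i+5))"
      using step[of i] step[of "i+1"] step[of "i+2"] step[of "i+3"] step[of "i+5"] per[of i]
      by (simp_all add: eval_nat_numeral)
    show ?thesis
    proof -
      have "(mat (1 - t (i+2) * t (i+3)) ** X (i+5) + mat (t (i+7) * t (i+5) + t (i+2)) ** X (i+4)
     + mat (t (i+7) - 1 + t (i+2) * t (i+3) * t (i+4)) ** X (i+3) + mat (t (i+2) * t (i+1) - t i - t (i+2) * t (i+3) * t (i+2)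
     - t (i+7) * t (i+3) - t (i+5))) $ k $ l = 0" for k l
      proof -
        have s': "X (i+3) $ k $ l = t (i+2) * X (i+1) $ k $ l + X i $ k $ l - mat (t i) $ k $ l"
          "X (i+4) $ k $ l = t (i+3) * X (i+2) $ k $ l + X (i+1) $ k $ l - mat (t (i+1)) $ k $ l"
          "X (i+5) $ k $ l = t (i+4) * X (i+3) $ k $ l + X (i+2) $ k $ l - mat (t (i+2)) $ k $ l"
          "X (i+6) $ k $ l = t (i+5) * X (i+4) $ k $ l + X (i+3) $ k $ l - mat (t (i+3)) $ k $ l"
          "X i $ k $ l = t (i+7) * X (i+6) $ k $ l + X (i+5) $ k $ l - mat (t (i+5)) $ k $ l"
          using s[THEN arg_cong, of "\<lambda>M. M $ k $ l"] by (simp_all add: mat_mult_entry)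
        have m: "(mat v :: cmat) $ k $ l = v * mat 1 $ k $ l" for v
          by (simp add: mat_def)
        show ?thesis
          using s' unfolding vector_add_component mat_mult_entry m[of "t _"] m[of "t _ * _ - _ - _ - _ - _"]
          by algebra
      qed
      then show ?thesis by (simp add: vec_eq_iff)
    qed
  qed
  have coef: "t (i+2) * t (i+3) = 1" "t (i+7) = 1 - t (i+2) * t (i+3) * t (i+4)" for i
  proof -
    have X5: "X (i+5) = X (i+4) ** X (i+3)" using rec[of "i+3"] by (simp add: eval_nat_numeral)
    have "det (X (i+3) ** X (i+4) - X (i+4) ** X (i+3)) \<noteq> 0"
      using Dj[of "i+3"] by (simp add: eval_nat_numeral)
    note indep = lin_indep_if_det_commutator[OF dep[of i, unfolded X5] this]
    show "t (i+2) * t (i+3) = 1" "t (i+7) = 1 - t (i+2) * t (i+3) * t (i+4)"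
      using indep(1) indep(3) by algebra+
  qed
  have tper: "t (j + 8) = t j" for j unfolding t_def per ..
  have c: "t 2 * t 3 = 1" "t 3 * t 4 = 1" "t 4 * t 5 = 1" "t 5 * t 6 = 1" "t 6 * t 7 = 1" "t 7 * t 8 = 1"
     "t 8 * t 9 = 1" "t 7 = 1 - t 2 * t 3 * t 4" "t 8 = t 0" "t 9 = t 1"
    using coef(1)[of 0] coef(1)[of 1] coef(1)[of 2] coef(1)[of 3] coef(1)[of 4] coef(1)[of 5] coef(1)[of 6]
      coef(2)[of 0] tper[of 0] tper[of 1] by (simp_all add: eval_nat_numeral)
  \<comment> \<open>Consecutive traces are inverse to each other, so the sequence has period 2, and
    the formula for \<open>t 7\<close> becomes \<open>t 3 = 1 - t 2\<close>.\<close>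
  then have eq: "t 4 = t 2" "t 5 = t 3" "t 6 = t 2" "t 7 = t 3" "t 0 = t 2" "t 1 = t 3"
    by (metis mult.commute mult_cancel_left zero_neq_one mult_zero_left)+
  have 3: "t 3 = 1 - t 2" using c eq by simp
  have "trace (X 0 ** X 1) = t 2"
    unfolding t_def trace_mul_sym[of "X 0" "X 1"] using rec[of 0] by (simp add: numeral_eq_Suc)
  then show "trace (X 0) = 1 - trace (X 1)" "trace (X 0 ** X 1) = 1 - trace (X 1)"
    using 3 eq unfolding t_def by simp_all
  have "t 1 * (1 - t 1) = 1" using 3 eq c(1) by (simp add: mult.commute)
  then show "(trace (X 1))^2 - trace (X 1) + 1 = 0"
    unfolding t_def by (simp add: algebra_simps power2_eq_square)
qed

text \<open>The matrix \<open>D = PQ - QP\<close> is singular iff \<open>P\<close> and \<open>Q\<close> have a common eigenvector;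
  then \<open>D\<^sup>2 = 0\<close>, and \<open>D P = tr P D - P D\<close> lets one move \<open>D\<close> past \<open>P\<close> and \<open>Q\<close>.\<close>
lemma singular_commutator_absorbs:
  assumes det: "det P = 1" "det Q = 1" and D: "det (P ** Q - Q ** P) = 0"
  shows "(P ** Q - Q ** P) ** lin P Q a b c d ** (P ** Q - Q ** P) = 0"
proof -
  define D where "D = P ** Q - Q ** P"
  have DD: "D ** D = 0"
  proof -
    have "D ** D = - mat (det D)"
      unfolding D_def by (simp add: mat2_simps algebra_simps)
    then show ?thesis using assms unfolding D_def by (simp add: mat2_simps)
  qed
  have DP: "D ** P = mat (trace P) ** D - P ** D" and DQ: "D ** Q = mat (trace Q) ** D - Q ** D"
    unfolding D_def by (simp_all add: mat2_simps algebra_simps)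
  have sub: "(M - N) ** K = M ** K - N ** K" for M N K :: cmat
    by (simp add: mat2_simps algebra_simps)
  have zero: "M ** (0 :: cmat) = 0" for M :: cmat
    by (simp add: mat2_simps)
  have DPD: "D ** P ** D = 0" and DQD: "D ** Q ** D = 0"
    unfolding DP DQ sub by (simp_all add: matrix_mul_assoc[symmetric] DD zero)
  have DPQD: "D ** (P ** Q) ** D = 0"
  proof -
    have "D ** (P ** Q) ** D = D ** P ** Q ** D" by (simp only: matrix_mul_assoc)
    also have "\<dots> = mat (trace P) ** (D ** Q ** D) - P ** (D ** Q ** D)"
      unfolding DP sub by (simp only: matrix_mul_assoc)
    finally show ?thesis by (simp add: DQD zero)
  qed
  have "D ** lin P Q a b c d ** D = mat a ** (D ** D) + mat b ** (D ** P ** D) + mat c ** (D ** Q ** D)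
      + mat d ** (D ** (P ** Q) ** D)"
    unfolding lin_def by (simp add: vec_eq_iff mat_mult_entry)
      (simp add: mat2_simps algebra_simps)
  then show ?thesis
    unfolding DD DPD DQD DPQD zero D_def[symmetric] by simp
qed

text \<open>If the commutator \<open>D\<close> is singular, \<open>D ** M ** D = 0\<close> holds on
  the image, hence by density on all of SL(2). That forces \<open>D = 0\<close>, against
  noncommutativity.\<close>

lemma zariski_dense_rep_det_commutator:
  assumes "group G" "zariski_dense_rep G \<rho>" "g \<in> carrier G" "h \<in> carrier G"
    and "carrier G \<subseteq> generate G {g, h}" "P \<in> \<rho> g" "Q \<in> \<rho> h"
  shows "det (P ** Q - Q ** P) \<noteq> 0"
proof
  assume D0: "det (P ** Q - Q ** P) = 0"
  have rep: "is_rep G \<rho>" and zd: "zariski_dense_SL2 (preimage_grp G \<rho>)"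
    using assms(2) unfolding zariski_dense_rep_def by blast+
  have det: "det P = 1" "det Q = 1"
    using rep_eq_lift[OF rep] assms by blast+
  define D where "D = P ** Q - Q ** P"
  have van: "(D ** M ** D) $ i $ j = 0" if "M \<in> preimage_grp G \<rho>" for M i j
    using rep_preimage_span[OF assms(1) rep assms(3-7) that]
      singular_commutator_absorbs[OF det D0, folded D_def] by auto
  have pf: "poly_fun (\<lambda>M. (D ** M ** D) $ i $ j)" for i j
    unfolding matrix_matrix_mult_def sum_2 by (simp, intro poly_fun_intros)
  have all: "(D ** M ** D) $ i $ j = 0" if "det M = 1" for M i j
    by (rule zariski_dense_vanish[OF zd pf van that])
  \<comment> \<open>Minus the identity these are the matrix units \<open>E12\<close> and
    \<open>E21\<close>; the entry \<open>(2,1)\<close> of \<open>D ** E12 ** D\<close> is the square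
    of \<open>D$2$1\<close>, and the entry \<open>(1,2)\<close> of \<open>D ** E21 ** D\<close> that
    of \<open>D$1$2\<close>.\<close>
  let ?U = "vector [vector [1, 1], vector [0, 1]] :: cmat"
  let ?L = "vector [vector [1, 0], vector [1, 1]] :: cmat"
  have 1: "(D ** mat 1 ** D) $ i $ j = 0" "(D ** ?U ** D) $ i $ j = 0" "(D ** ?L ** D) $ i $ j = 0" for i j
    by (intro all; simp add: det_2 mat_def)+
  have 21: "D$2$1 * D$2$1 = 0"
    using 1(1)[of 2 1] 1(2)[of 2 1] unfolding mat2_simps by simp algebra
  have 12: "D$1$2 * D$1$2 = 0"
    using 1(1)[of 1 2] 1(3)[of 1 2] unfolding mat2_simps by simp algebra
  have "D$1$1 * D$1$1 = 0" "D$2$2 * D$2$2 = 0"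
    using 1(1)[of 1 1] 1(1)[of 2 2] 12 21 by (simp_all add: mat2_simps)
  then have "D = 0" using 12 21 by (simp add: vec_eq_iff forall_2)
  then show False
    using zariski_dense_rep_noncommuting[OF assms] unfolding D_def by simp
qed

text \<open>The commutator \<open>c = P ** Q ** U\<close> is \<open>mat 1 + D ** U\<close>, and
  \<open>adj2 P ** c ** P\<close> is likewise \<open>mat 1\<close> plus a product containing
  \<open>D\<close>. Multiplied in either order, the two added terms contain some
  \<open>D ** M ** D\<close> with \<open>M\<close> in the span and vanish, so the two matrices
  commute. The claim says this with \<open>adj2 Q ** Q\<close> cancelled on the left.\<close>

lemma singular_commutator_metabelian:
  assumes det: "det P = 1" "det Q = 1" and D: "det (P ** Q - Q ** P) = 0"
  shows "P ** Q ** adj2 P ** adj2 P ** adj2 Q ** P = Q ** adj2 P ** adj2 Q ** P ** P ** Q ** adj2 P ** adj2 Q"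
proof -
  define D where "D = P ** Q - Q ** P"
  define U where "U = adj2 P ** adj2 Q"
  have PQ: "P ** Q = Q ** P + D" unfolding D_def by simp
  have "Q ** P ** (adj2 P ** adj2 Q) = Q ** (P ** adj2 P) ** adj2 Q"
    by (simp only: matrix_mul_assoc)
  also have "\<dots> = mat 1" by (simp add: adj2_mult det)
  finally have QPU: "Q ** P ** U = mat 1" unfolding U_def .
  have C: "P ** Q ** U = mat 1 + D ** U"
    unfolding PQ matrix_add_distribs QPU ..
  have "adj2 P ** (P ** Q ** U) ** P = adj2 P ** (mat 1 + D ** U) ** P"
    unfolding C ..
  also have "\<dots> = mat 1 + adj2 P ** D ** U ** P"
    by (simp add: matrix_add_distribs matrix_mul_assoc adj2_mult det)
  finally have C': "adj2 P ** (P ** Q ** U) ** P = mat 1 + adj2 P ** D ** U ** P" .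
  have span: "D ** M ** D = 0" if "\<exists>a b c d. M = lin P Q a b c d" for M
    using that singular_commutator_absorbs[OF det D, folded D_def] by auto
  have adjP: "adj2 P = lin P Q (trace P) (-1) 0 0"
    using lin_mult_adj2_left_gen[OF det, of 1 0 0 0] by (simp add: lin_basis)
  have "U ** adj2 P = lin P Q (trace P) (-1) 0 0 ** adj2 Q ** adj2 P"
    "U ** P = lin P Q (trace P) (-1) 0 0 ** adj2 Q ** P"
    unfolding U_def adjP[symmetric] by (rule HOL.refl)+
  then have 1: "D ** (U ** adj2 P) ** D = 0" and 2: "D ** (U ** P) ** D = 0"
    by (intro span; (simp only: lin_mult_adj2_right_gen[OF det] lin_mult_adj2_left_gen[OF det]
        lin_mult_left_gen[OF det], blast))+
  have zl: "(0 :: cmat) ** M = 0" and zr: "M ** (0 :: cmat) = 0" for M :: cmat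
    by (simp_all add: mat2_simps)
  have "D ** U ** (adj2 P ** D ** U ** P) = (D ** (U ** adj2 P) ** D) ** U ** P"
    by (simp only: matrix_mul_assoc)
  then have 3: "D ** U ** (adj2 P ** D ** U ** P) = 0" unfolding 1 zl .
  have "adj2 P ** D ** U ** P ** (D ** U) = adj2 P ** (D ** (U ** P) ** D) ** U"
    by (simp only: matrix_mul_assoc)
  then have 4: "adj2 P ** D ** U ** P ** (D ** U) = 0" unfolding 2 zl zr .
  have comm: "(P ** Q ** U) ** (adj2 P ** (P ** Q ** U) ** P) = (adj2 P ** (P ** Q ** U) ** P) ** (P ** Q ** U)"
    unfolding C' unfolding C by (simp add: matrix_add_distribs 3 4)
  have c2: "adj2 P ** (P ** Q ** U) ** P = Q ** adj2 P ** adj2 Q ** P"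
    unfolding U_def by (simp add: matrix_mul_assoc adj2_mult det)
  have "(P ** Q ** U) ** (Q ** adj2 P ** adj2 Q ** P) = P ** Q ** adj2 P ** (adj2 Q ** Q) ** adj2 P ** adj2 Q ** P"
    unfolding U_def by (simp only: matrix_mul_assoc)
  also have "\<dots> = P ** Q ** adj2 P ** adj2 P ** adj2 Q ** P" by (simp add: adj2_mult det)
  finally show ?thesis
    using comm[unfolded c2] unfolding U_def by (simp only: matrix_mul_assoc)
qed

text \<open>The left hand side is \<open>c c'\<close> and the right hand side \<open>c' c\<close>, where \<open>c = P Q P\<inverse> Q\<inverse>\<close> and
  \<open>c' = P\<inverse> c P\<close>.\<close>
lemma fib8_not_metabelian:
  assumes det: "det P = 1" "det Q = 1" and D: "det (P ** Q - Q ** P) \<noteq> 0"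
    and tr: "trace P = 1 - z" "trace Q = z" "trace (P ** Q) = 1 - z" and z: "z^2 - z + 1 = 0"
  defines "L \<equiv> P ** Q ** adj2 P ** adj2 P ** adj2 Q ** P"
    and "R \<equiv> Q ** adj2 P ** adj2 Q ** P ** P ** Q ** adj2 P ** adj2 Q"
  shows "L \<noteq> R" "L \<noteq> - R"
proof -
  have zz: "z * z = z - 1" using z by (simp add: power2_eq_square algebra_simps)
  have zzc: "z * (z * c) = z * c - c" for c
    by (simp only: mult.assoc[symmetric] zz left_diff_distrib mult_1)
  note m = lin_mult_adj2_right_gen[OF det, unfolded tr] lin_mult_adj2_left_gen[OF det, unfolded tr]
        lin_mult_left_gen[OF det, unfolded tr] lin_mult_right_gen[OF det, unfolded tr]
  \<comment> \<open>The words are multiplied out one letter at a time in the coordinates of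
    \<open>lin\<close>, with \<open>z * z\<close> replaced by \<open>z - 1\<close>.\<close>
  have L: "L = lin P Q (1 + 2 * z) (-4 + 3 * z) (-1) 1"
  proof -
    have "L = lin P Q 0 1 0 0 ** Q ** adj2 P ** adj2 P ** adj2 Q ** P"
      unfolding L_def lin_basis ..
    also have "lin P Q 0 1 0 0 ** Q = lin P Q 0 0 0 1"
      unfolding m by simp
    also have "lin P Q 0 0 0 1 ** adj2 P = lin P Q z (z - 1) (-1) (1 - z)"
      unfolding m by (rule lin_cong; simp)
    also have "lin P Q z (z - 1) (-1) (1 - z) ** adj2 P = lin P Q 1 z (z - 1) (- 1 - z)"
      unfolding m by (rule lin_cong; simp add: algebra_simps zz zzc)
    also have "lin P Q 1 z (z - 1) (- 1 - z) ** adj2 Q = lin P Q (2 * z - 1) (-2) (-1) (- z)"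
      unfolding m by (rule lin_cong; simp add: algebra_simps zz zzc)
    also have "lin P Q (2 * z - 1) (-2) (-1) (- z) ** P = lin P Q (1 + 2 * z) (-4 + 3 * z) (-1) 1"
      unfolding m by (rule lin_cong; simp add: algebra_simps zz zzc)
    finally show ?thesis .
  qed
  have R: "R = lin P Q (1 - 4 * z) (-4 + 9 * z) 5 (-5)"
  proof -
    have "R = lin P Q 0 0 1 0 ** adj2 P ** adj2 Q ** P ** P ** Q ** adj2 P ** adj2 Q"
      unfolding R_def lin_basis ..
    also have "lin P Q 0 0 1 0 ** adj2 P = lin P Q z (- z) 0 1"
      unfolding m by (rule lin_cong; simp add: algebra_simps zz zzc)
    also have "lin P Q z (- z) 0 1 ** adj2 Q = lin P Q (z - 1) (2 - z) (- z) z"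
      unfolding m by (rule lin_cong; simp add: algebra_simps zz zzc)
    also have "lin P Q (z - 1) (2 - z) (- z) z ** P = lin P Q (z - 2) (2 - 2 * z) (z - 1) z"
      unfolding m by (rule lin_cong; simp add: algebra_simps zz zzc)
    also have "lin P Q (z - 2) (2 - 2 * z) (z - 1) z ** P = lin P Q z (- 2 - z) (2 * z) (1 - z)"
      unfolding m by (rule lin_cong; simp add: algebra_simps zz zzc)
    also have "lin P Q z (- 2 - z) (2 * z) (1 - z) ** Q = lin P Q (- 2 * z) (z - 1) (3 * z - 2) (- 1 - z)"
      unfolding m by (rule lin_cong; simp add: algebra_simps zz zzc)
    also have "lin P Q (- 2 * z) (z - 1) (3 * z - 2) (- 1 - z) ** adj2 P = lin P Q (-5) 5 (1 + z) (4 * z - 4)"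
      unfolding m by (rule lin_cong; simp add: algebra_simps zz zzc)
    also have "lin P Q (-5) 5 (1 + z) (4 * z - 4) ** adj2 Q = lin P Q (1 - 4 * z) (-4 + 9 * z) 5 (-5)"
      unfolding m by (rule lin_cong; simp add: algebra_simps zz zzc)
    finally show ?thesis .
  qed
  have indep: "d = 0" if "lin P Q a b c d = 0" for a b c d
  proof -
    have "mat d ** (P ** Q) + mat b ** P + mat c ** Q + mat a = lin P Q a b c d"
      by (simp add: lin_def mat2_simps)
    then have "mat d ** (P ** Q) + mat b ** P + mat c ** Q + mat a = 0"
      unfolding that .
    moreover have "det (Q ** P - P ** Q) \<noteq> 0"
      using D by (simp add: det_2 algebra_simps)
    ultimately show ?thesis using lin_indep_if_det_commutator(1) by blast
  qed
  \<comment> \<open>The coefficient of \<open>P ** Q\<close> is 6 in \<open>L - R\<close> and,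
    below, -4 in \<open>L + R\<close>; neither is zero.\<close>
  have "lin P Q (1 + 2 * z - (1 - 4 * z)) (-4 + 3 * z - (-4 + 9 * z)) (-1 - 5) (1 - (-5)) = L - R"
    unfolding L R lin_diff ..
  then show "L \<noteq> R" using indep by force
  have "lin P Q (1 + 2 * z - - (1 - 4 * z)) (-4 + 3 * z - - (-4 + 9 * z)) (-1 - - 5) (1 - - (-5)) = L - - R"
    unfolding L R lin_uminus lin_diff ..
  then show "L \<noteq> - R" using indep by force
qed

text \<open>Density gives the nonsingular commutator required by \<open>fib8_traces\<close> for
  \<open>\<rho>\<close>; for \<open>\<rho>0\<close> it has to come from faithfulness. On both sides
  the three traces are then the same integral affine functions of a root of
  \<open>z^2 - z + 1\<close>.\<close>

lemma fib8_galois_conjugate: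
  assumes G: "group G" "\<And>j. f j \<in> carrier G" "carrier G \<subseteq> generate G {f 0, f 1}"
    and rec: "\<And>j. f (Suc (Suc j)) = f (Suc j) \<otimes>\<^bsub>G\<^esub> f j" and per: "f 8 = f 0" "f 9 = f 1"
    and \<rho>0: "is_rep G \<rho>0" "inj_on \<rho>0 (carrier G)" and \<rho>: "zariski_dense_rep G \<rho>"
    and iso: "\<And>z0 z :: complex. z0^2 - z0 + 1 = 0 \<Longrightarrow> z^2 - z + 1 = 0 \<Longrightarrow> \<exists>J. ring_iso_graph J \<and> (z0, z) \<in> J"
  shows "\<exists>\<sigma>. galois_conjugate G \<rho>0 \<sigma> \<rho>"
proof -
  interpret group G by fact
  have rep: "is_rep G \<rho>" using \<rho> unfolding zariski_dense_rep_def by blast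
  obtain X where X: "\<And>j. X j \<in> \<rho> (f j)" "\<And>j. X (Suc (Suc j)) = X (Suc j) ** X j" "\<And>j. X (j + 8) = X j"
    by (rule fib_rep_lifts[OF G(1) rep G(2) rec per]) blast
  obtain Y where Y: "\<And>j. Y j \<in> \<rho>0 (f j)" "\<And>j. Y (Suc (Suc j)) = Y (Suc j) ** Y j" "\<And>j. Y (j + 8) = Y j"
    by (rule fib_rep_lifts[OF G(1) \<rho>0(1) G(2) rec per]) blast
  have detX: "det (X j) = 1" for j using rep_eq_lift(2)[OF rep G(2) X(1)] .
  have detY: "det (Y j) = 1" for j using rep_eq_lift(2)[OF \<rho>0(1) G(2) Y(1)] .
  have DX: "det (X 0 ** X 1 - X 1 ** X 0) \<noteq> 0"
    using zariski_dense_rep_det_commutator[OF G(1) \<rho> G(2,2,3) X(1,1)] .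
  note tX = fib8_traces[OF detX X(2,3) DX]
  \<comment> \<open>A singular commutator would force \<open>?l = ?r\<close> in the group by
    faithfulness of \<open>\<rho>0\<close>; then \<open>\<rho>\<close> would satisfy this relation
    up to sign, which its known traces exclude.\<close>
  have DY: "det (Y 0 ** Y 1 - Y 1 ** Y 0) \<noteq> 0"
  proof
    assume 0: "det (Y 0 ** Y 1 - Y 1 ** Y 0) = 0"
    let ?l = "f 0 \<otimes>\<^bsub>G\<^esub> f 1 \<otimes>\<^bsub>G\<^esub> inv\<^bsub>G\<^esub> f 0 \<otimes>\<^bsub>G\<^esub> inv\<^bsub>G\<^esub> f 0 \<otimes>\<^bsub>G\<^esub> inv\<^bsub>G\<^esub> f 1 \<otimes>\<^bsub>G\<^esub> f 0"
    let ?r = "f 1 \<otimes>\<^bsub>G\<^esub> inv\<^bsub>G\<^esub> f 0 \<otimes>\<^bsub>G\<^esub> inv\<^bsub>G\<^esub> f 1 \<otimes>\<^bsub>G\<^esub> f 0 \<otimes>\<^bsub>G\<^esub> f 0 \<otimes>\<^bsub>G\<^esub> f 1 \<otimes>\<^bsub>G\<^esub> inv\<^bsub>G\<^esub> f 0 \<otimes>\<^bsub>G\<^esub> inv\<^bsub>G\<^esub> f 1"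
    have cl: "?l \<in> carrier G" "?r \<in> carrier G" using G(2) by simp_all
    have l: "P ** Q ** adj2 P ** adj2 P ** adj2 Q ** P \<in> r ?l"
      and r: "Q ** adj2 P ** adj2 Q ** P ** P ** Q ** adj2 P ** adj2 Q \<in> r ?r"
      if "is_rep G r" "P \<in> r (f 0)" "Q \<in> r (f 1)" for P Q r
      using G(2) by (intro rep_mult[OF that(1)] rep_inv[OF G(1) that(1)] that(2,3); simp)+
    have "?l = ?r"
      using rep_eq_if_common_lift[OF \<rho>0 cl l[OF \<rho>0(1) Y(1,1)]] r[OF \<rho>0(1) Y(1,1)]
        singular_commutator_metabelian[OF detY detY 0] by simp
    then have "X 0 ** X 1 ** adj2 (X 0) ** adj2 (X 0) ** adj2 (X 1) ** X 0 \<in> \<rho> ?r"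
      using l[OF rep X(1,1)] by simp
    then show False
      using rep_eq_lift(1)[OF rep cl(2) r[OF rep X(1,1)]]
        fib8_not_metabelian[OF detX detX DX tX(1) HOL.refl tX(2,3)] by blast
  qed
  note tY = fib8_traces[OF detY Y(2,3) DY]
  obtain J where J: "ring_iso_graph J" "(trace (Y 1), trace (X 1)) \<in> J"
    using iso[OF tY(3) tX(3)] by blast
  have 1: "(1 - trace (Y 1), 1 - trace (X 1)) \<in> J"
    by (intro ring_iso_graph_closed[OF J(1)] J)
  show ?thesis
    by (rule galois_conjugate_from_generators[OF G(1) \<rho>0(1) \<rho> G(2,2,3) Y(1) X(1) Y(1) X(1) J(1)])
       (use 1 J(2) in \<open>simp_all only: tX(1,2) tY(1,2)\<close>)
qed

subsection \<open>Conjugate algebraic numbers\<close>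

definition int_poly_at :: "int poly \<Rightarrow> complex \<Rightarrow> complex" where
  "int_poly_at f x = poly (map_poly of_int f) x"

lemma int_poly_at_0 [simp]: "int_poly_at 0 x = 0"
  by (simp add: int_poly_at_def)

lemma int_poly_at_pCons [simp]: "int_poly_at (pCons a f) x = of_int a + x * int_poly_at f x"
  by (simp add: int_poly_at_def map_poly_pCons)

lemma int_poly_at_1 [simp]: "int_poly_at 1 x = 1"
  by (simp add: one_pCons)

lemma int_poly_at_add [simp]: "int_poly_at (f + g) x = int_poly_at f x + int_poly_at g x"
  by (induction f g rule: poly_induct2) (simp_all add: algebra_simps)

lemma int_poly_at_smult [simp]: "int_poly_at (smult c f) x = of_int c * int_poly_at f x"
  by (induction f) (simp_all add: algebra_simps)

lemma int_poly_at_minus [simp]: "int_poly_at (- f) x = - int_poly_at f x"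
  using int_poly_at_smult[of "-1" f x] by simp

lemma int_poly_at_diff [simp]: "int_poly_at (f - g) x = int_poly_at f x - int_poly_at g x"
  using int_poly_at_add[of f "- g" x] by simp

lemma int_poly_at_mult [simp]: "int_poly_at (f * g) x = int_poly_at f x * int_poly_at g x"
  by (induction f) (simp_all add: algebra_simps)

lemma int_poly_at_power [simp]: "int_poly_at (f ^ n) x = int_poly_at f x ^ n"
  by (induction n) simp_all

lemma int_poly_at_sum [simp]: "int_poly_at (\<Sum>i\<in>S. f i) x = (\<Sum>i\<in>S. int_poly_at (f i) x)"
  by (induction S rule: infinite_finite_induct) simp_all

lemma int_poly_at_monom [simp]: "int_poly_at (monom c n) x = of_int c * x ^ n"
  by (induction n) (simp_all add: monom_0 monom_Suc algebra_simps)

lemma int_poly_at_pcompose [simp]: "int_poly_at (pcompose f g) x = int_poly_at f (int_poly_at g x)"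
  by (induction f) (simp_all add: pcompose_pCons)

lemma int_poly_at_of_real: "int_poly_at f (of_real r) \<in> \<real>"
  by (induction f) auto

text \<open>For algebraic numbers this is equality of the minimal polynomials over the rationals,
  with denominators cleared.\<close>

definition conjugate_numbers :: "complex \<Rightarrow> complex \<Rightarrow> bool" where
  "conjugate_numbers x y \<longleftrightarrow> (\<forall>f. int_poly_at f x = 0 \<longleftrightarrow> int_poly_at f y = 0)"

lemma conjugate_numbers_int_poly_at:
  "conjugate_numbers x y \<Longrightarrow> conjugate_numbers (int_poly_at g x) (int_poly_at g y)"
  unfolding conjugate_numbers_def by (metis int_poly_at_pcompose)

section \<open>Irreducibility by Eisenstein's criterion\<close>

definition eisenstein :: "int \<Rightarrow> int poly \<Rightarrow> bool" where
  "eisenstein p f \<longleftrightarrow> prime p \<and> lead_coeff f = 1 \<and> degree f > 0 \<and>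
     (\<forall>i < degree f. p dvd coeff f i) \<and> \<not> p^2 dvd coeff f 0"

text \<open>Let \<open>i\<close> be the first index whose coefficient in \<open>g\<close> is not
  divisible by \<open>p\<close>. If \<open>h\<close> were nonconstant, \<open>i\<close> would lie
  below the degree of \<open>g * h\<close>, where the coefficient is congruent to
  \<open>coeff g i * coeff h 0\<close> modulo \<open>p\<close> and hence not divisible by
  \<open>p\<close>.\<close>

lemma eisenstein_factor_const_aux:
  assumes "eisenstein p (g * h)" "p dvd coeff g 0" "\<not> p dvd coeff h 0"
  shows "degree h = 0"
proof (rule ccontr)
  assume dh: "degree h \<noteq> 0"
  have p: "prime p" and lead: "lead_coeff g * lead_coeff h = 1"
    and low: "\<And>i. i < degree (g * h) \<Longrightarrow> p dvd coeff (g * h) i"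
    using assms(1) unfolding eisenstein_def by (auto simp: lead_coeff_mult)
  have nz: "g \<noteq> 0" "h \<noteq> 0" using lead by auto
  have "\<not> p dvd lead_coeff g"
    using lead p by (metis dvd_mult2 not_prime_unit)
  then have ex: "\<exists>i. \<not> p dvd coeff g i" by blast
  define i where "i = (LEAST i. \<not> p dvd coeff g i)"
  have i: "\<not> p dvd coeff g i" unfolding i_def using LeastI_ex[OF ex] .
  have less: "p dvd coeff g j" if "j < i" for j
    using not_less_Least[of j "\<lambda>i. \<not> p dvd coeff g i"] that unfolding i_def by blast
  have "i \<le> degree g" using \<open>\<not> p dvd lead_coeff g\<close> unfolding i_def by (rule Least_le)
  then have "i < degree (g * h)" using dh nz by (simp add: degree_mult_eq)
  then have "p dvd coeff (g * h) i" by (rule low)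
  moreover have "coeff (g * h) i = (\<Sum>j<i. coeff g j * coeff h (i - j)) + coeff g i * coeff h 0"
    by (simp add: coeff_mult lessThan_Suc_atMost[symmetric])
  moreover have "p dvd (\<Sum>j<i. coeff g j * coeff h (i - j))"
    using less by (intro dvd_sum) auto
  ultimately have "p dvd coeff g i * coeff h 0"
    by (simp add: dvd_add_right_iff)
  then show False using i assms(3) p by (simp add: prime_dvd_mult_iff)
qed

lemma eisenstein_factor_const:
  assumes "eisenstein p (g * h)"
  shows "degree g = 0 \<or> degree h = 0"
proof -
  have p: "prime p" and 0: "p dvd coeff g 0 * coeff h 0" "\<not> p^2 dvd coeff g 0 * coeff h 0"
    using assms unfolding eisenstein_def by (auto simp: coeff_mult_0)
  have "\<not> (p dvd coeff g 0 \<and> p dvd coeff h 0)"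
    using 0(2) by (auto simp: power2_eq_square intro: mult_dvd_mono)
  moreover have "p dvd coeff g 0 \<or> p dvd coeff h 0"
    using 0(1) p by (simp add: prime_dvd_mult_iff)
  ultimately show ?thesis
    using eisenstein_factor_const_aux[of p g h] eisenstein_factor_const_aux[of p h g] assms
    by (auto simp: mult.commute)
qed

text \<open>A primitive polynomial \<open>m'\<close> of least degree vanishing at \<open>x\<close>
  divides a constant multiple of \<open>f\<close> by pseudo-division, and \<open>f\<close> itself by
  Gauss's lemma on contents. The Eisenstein property makes the cofactor constant.\<close>

lemma eisenstein_root_min_degree:
  assumes f: "eisenstein p f" "int_poly_at f x = 0"
    and g: "g \<noteq> 0" "int_poly_at g x = 0"
  shows "degree f \<le> degree g"
proof -
  define P where "P k \<longleftrightarrow> (\<exists>g. g \<noteq> 0 \<and> int_poly_at g x = 0 \<and> degree g = k)" for k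
  have exP: "\<exists>k. P k" using g unfolding P_def by blast
  define d where "d = (LEAST k. P k)"
  have "P d" unfolding d_def using LeastI_ex[OF exP] .
  then obtain m where m: "m \<noteq> 0" "int_poly_at m x = 0" "degree m = d" unfolding P_def by blast
  have min: "d \<le> degree h" if "h \<noteq> 0" "int_poly_at h x = 0" for h
    unfolding d_def using that by (intro Least_le) (auto simp: P_def)
  define m' where "m' = primitive_part m"
  have m'_eq: "m = smult (content m) m'" unfolding m'_def by simp
  have m': "m' \<noteq> 0" "int_poly_at m' x = 0" "degree m' = d" "content m' = 1"
  proof -
    show "m' \<noteq> 0" unfolding m'_def using m by simp
    have "of_int (content m) * int_poly_at m' x = 0"
      using m(2) m'_eq by (metis int_poly_at_smult)
    then show "int_poly_at m' x = 0" using m(1) by simp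
    show "degree m' = d" unfolding m'_def using m by simp
    show "content m' = 1" unfolding m'_def using m by simp
  qed
  define r where "r = pseudo_mod f m'"
  obtain a q where aq: "a \<noteq> 0" "smult a f = m' * q + r"
    using pseudo_mod(1)[OF m'(1), of f] unfolding r_def by blast
  have rdeg: "r = 0 \<or> degree r < degree m'"
    using pseudo_mod(2)[OF m'(1), of f] unfolding r_def by blast
  have "int_poly_at (smult a f) x = int_poly_at (m' * q + r) x" using aq(2) by simp
  then have "int_poly_at r x = 0" using f(2) m'(2) by simp
  then have "r = 0" using rdeg min[of r] m'(3) by force
  then have eq: "smult a f = m' * q" using aq by simp
  have "content f dvd coeff f (degree f)" by (rule content_dvd_coeff)
  then have cf: "content f = 1"
    using f(1) unfolding eisenstein_def by (metis is_unit_content_iff)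
  have "content q = \<bar>a\<bar>"
    using arg_cong[OF eq, of content] cf m'(4) by (simp add: content_mult)
  then have "smult a f = smult \<bar>a\<bar> (m' * primitive_part q)"
    using eq content_times_primitive_part[of q] by (metis mult_smult_right)
  then have "smult a f = smult a (smult (sgn a) (m' * primitive_part q))"
    by (simp add: abs_sgn mult.commute)
  then have "f = smult (sgn a) (m' * primitive_part q)"
    using aq(1) by (metis smult_cancel)
  then have ff: "f = m' * smult (sgn a) (primitive_part q)" by simp
  then have "degree m' = 0 \<or> degree (smult (sgn a) (primitive_part q)) = 0"
    using eisenstein_factor_const f(1) by metis
  moreover have "degree m' \<noteq> 0"
  proof
    assume "degree m' = 0"
    then obtain c where "m' = [:c:]" by (metis degree_0_id)
    then show False using m'(1,2) by simp
  qed
  ultimately have "degree f = degree m'"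
    using ff f(1) unfolding eisenstein_def
    by (metis add.right_neutral degree_mult_eq degree_0 less_irrefl mult_zero_right)
  then show ?thesis using m'(3) min[OF g] by simp
qed

text \<open>If \<open>h\<close> vanishes at one root, so does its pseudo-remainder by
  \<open>f\<close>, which is zero for degree reasons; thus \<open>f\<close> divides a nonzero
  constant multiple of \<open>h\<close>.\<close>

lemma eisenstein_roots_conjugate:
  assumes f: "eisenstein p f" "int_poly_at f x = 0" "int_poly_at f y = 0"
  shows "conjugate_numbers x y"
proof -
  have *: "int_poly_at h y = 0" if x: "int_poly_at f x = 0" "int_poly_at f y = 0" and h: "int_poly_at h x = 0" for h x y
  proof -
    have "f \<noteq> 0" using f(1) unfolding eisenstein_def by auto
    define r where "r = pseudo_mod h f"
    obtain a q where aq: "a \<noteq> 0" "smult a h = f * q + r"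
      using pseudo_mod(1)[OF \<open>f \<noteq> 0\<close>, of h] unfolding r_def by blast
    have rdeg: "r = 0 \<or> degree r < degree f"
      using pseudo_mod(2)[OF \<open>f \<noteq> 0\<close>, of h] unfolding r_def by blast
    have "int_poly_at (smult a h) x = int_poly_at (f * q + r) x" using aq(2) by simp
    then have "int_poly_at r x = 0" using x h by simp
    then have "r = 0" using rdeg eisenstein_root_min_degree[OF f(1) x(1), of r] by force
    then have "int_poly_at (smult a h) y = 0" using aq x by simp
    then show ?thesis using aq(1) by simp
  qed
  then show ?thesis unfolding conjugate_numbers_def using f(2,3) by blast
qed

text \<open>Over a real conjugate \<open>r\<close> of \<open>x\<close> the norm form of \<open>\<rat>(x)(z)\<close> over \<open>\<rat>(x)\<close> is definite, so it
  only represents zero trivially; this property then passes to all conjugates.\<close>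
lemma ring_iso_graph_quadratic:
  fixes x0 z0 x z :: complex and r :: real
  assumes conj: "conjugate_numbers x0 (of_real r)" "conjugate_numbers x (of_real r)"
    and r: "1 < r^2" "r^2 < 5"
    and z0: "z0^2 - (x0^2 - 1) * z0 + (x0^2 - 1) = 0" and z: "z^2 - (x^2 - 1) * z + (x^2 - 1) = 0"
  shows "\<exists>J. ring_iso_graph J \<and> (x0, x) \<in> J \<and> (z0, z) \<in> J"
proof -
  define J where "J = {(int_poly_at a x0 + int_poly_at b x0 * z0, int_poly_at a x + int_poly_at b x * z) | a b. True}"
  have JI: "(u, v) \<in> J" if "u = int_poly_at a x0 + int_poly_at b x0 * z0" "v = int_poly_at a x + int_poly_at b x * z" for u v a b
    using that unfolding J_def by blast
  have zero: "int_poly_at a (of_real r) = 0 \<and> int_poly_at b (of_real r) = 0"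
    if conj: "conjugate_numbers x (of_real r)" and z: "z^2 - (x^2 - 1) * z + (x^2 - 1) = 0"
      and 0: "int_poly_at a x + int_poly_at b x * z = 0" for a b x z
  proof -
    let ?s = "[:-1, 0, 1:] :: int poly"
    \<comment> \<open>This is the norm of \<open>a + b z\<close>, as the roots of the equation for
      \<open>z\<close> have sum and product \<open>x^2 - 1\<close>.\<close>
    have "int_poly_at (a * a + a * b * ?s + b * b * ?s) x =
      (int_poly_at a x)^2 + int_poly_at a x * int_poly_at b x * (x^2 - 1) + (int_poly_at b x)^2 * (x^2 - 1)"
      by (simp add: power2_eq_square algebra_simps)
    also have "\<dots> = 0" using 0 z by algebra
    finally have N: "int_poly_at (a * a + a * b * ?s + b * b * ?s) (of_real r) = 0"
      using conj unfolding conjugate_numbers_def by blast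
    obtain \<alpha> \<beta> where ab: "int_poly_at a (of_real r) = of_real \<alpha>" "int_poly_at b (of_real r) = of_real \<beta>"
      using int_poly_at_of_real by (meson Reals_cases)
    define s where "s = r^2 - 1"
    have "of_real (\<alpha>^2 + \<alpha> * \<beta> * s + \<beta>^2 * s) = (0 :: complex)"
      using N unfolding s_def by (simp add: ab power2_eq_square algebra_simps)
    then have n: "\<alpha>^2 + \<alpha> * \<beta> * s + \<beta>^2 * s = 0" by (simp only: of_real_eq_0_iff)
    \<comment> \<open>Completing the square; the bounds on \<open>r\<close> say
      \<open>0 < s < 4\<close>, so the form is positive definite.\<close>
    have "(\<alpha> + \<beta> * s / 2)^2 + \<beta>^2 * (s * (4 - s) / 4) = \<alpha>^2 + \<alpha> * \<beta> * s + \<beta>^2 * s"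
      by (simp add: power2_eq_square field_simps)
    then have n': "(\<alpha> + \<beta> * s / 2)^2 + \<beta>^2 * (s * (4 - s) / 4) = 0" using n by simp
    have pos: "s * (4 - s) / 4 > 0" using r unfolding s_def by (intro divide_pos_pos mult_pos_pos) auto
    then have "\<beta>^2 * (s * (4 - s) / 4) \<ge> 0" by simp
    then have "\<beta>^2 * (s * (4 - s) / 4) = 0" and 2: "(\<alpha> + \<beta> * s / 2)^2 = 0"
      using n' zero_le_power2[of "\<alpha> + \<beta> * s / 2"] by linarith+
    then have "\<beta> = 0" using pos by (metis less_irrefl mult_eq_0_iff power_eq_0_iff)
    then show ?thesis using 2 ab by simp
  qed
  have transfer: "int_poly_at a x + int_poly_at b x * z = 0"
    if "conjugate_numbers x (of_real r)" "int_poly_at a (of_real r) = 0 \<and> int_poly_at b (of_real r) = 0" for a b x z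
    using that unfolding conjugate_numbers_def by (metis add_0 mult_zero_left)
  have "ring_iso_graph J"
    unfolding ring_iso_graph_def
  proof (intro conjI allI impI)
    show "(1, 1) \<in> J" by (rule JI[of _ 1 0]) simp_all
    fix u v u' v' assume "(u, v) \<in> J" "(u', v') \<in> J"
    then obtain a b a' b' where
      uv: "u = int_poly_at a x0 + int_poly_at b x0 * z0" "v = int_poly_at a x + int_poly_at b x * z"
      "u' = int_poly_at a' x0 + int_poly_at b' x0 * z0" "v' = int_poly_at a' x + int_poly_at b' x * z"
      unfolding J_def by blast
    show "(u - u', v - v') \<in> J"
      by (rule JI[of _ "a - a'" "b - b'"]) (simp_all add: uv algebra_simps)
    have mul: "(int_poly_at a x + int_poly_at b x * z) * (int_poly_at a' x + int_poly_at b' x * z) =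
      int_poly_at (a * a' - b * b' * [:-1, 0, 1:]) x + int_poly_at (a * b' + b * a' + b * b' * [:-1, 0, 1:]) x * z"
      if "z^2 - (x^2 - 1) * z + (x^2 - 1) = 0" for x z
      using that by simp algebra
    show "(u * u', v * v') \<in> J"
      unfolding uv by (rule JI[OF mul[OF z0] mul[OF z]])
  next
    fix u v assume "(u, v) \<in> J"
    then obtain a b where
      uv: "u = int_poly_at a x0 + int_poly_at b x0 * z0" "v = int_poly_at a x + int_poly_at b x * z"
      unfolding J_def by blast
    show "u = 0 \<longleftrightarrow> v = 0"
      unfolding uv using zero[OF conj(1) z0, of a b] zero[OF conj(2) z, of a b]
        transfer[OF conj(1), of a b z0] transfer[OF conj(2), of a b z] by blast
  qed
  moreover have "(x0, x) \<in> J" by (rule JI[of _ "[:0, 1:]" 0]) simp_all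
  moreover have "(z0, z) \<in> J" by (rule JI[of _ 0 1]) simp_all
  ultimately show ?thesis by blast
qed

text \<open>The norm form \<open>a^2 + a * b + b^2\<close> is positive definite, so a number
  determines its coefficients \<open>a\<close>, \<open>b\<close>, and the two rings correspond
  coefficientwise.\<close>

lemma ring_iso_graph_eisenstein_integers:
  fixes z0 z :: complex
  assumes z0: "z0^2 - z0 + 1 = 0" and z: "z^2 - z + 1 = 0"
  shows "\<exists>J. ring_iso_graph J \<and> (z0, z) \<in> J"
proof -
  define J where "J = {(of_int a + of_int b * z0, of_int a + of_int b * z) | a b. True}"
  have JI: "(u, v) \<in> J" if "u = of_int a + of_int b * z0" "v = of_int a + of_int b * z" for u v a b
    using that unfolding J_def by blast
  have zero: "a = 0 \<and> b = 0" if "z^2 - z + 1 = 0" "of_int a + of_int b * z = 0" for a b and z :: complex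
  proof -
    have "of_int (a^2 + a * b + b^2) = (0 :: complex)"
      using that by simp algebra
    then have n: "a^2 + a * b + b^2 = 0" by (simp only: of_int_eq_0_iff)
    have "(2 * a + b)^2 + 3 * b^2 = 4 * (a^2 + a * b + b^2)"
      by (simp add: power2_eq_square algebra_simps)
    then have n': "(2 * a + b)^2 + 3 * b^2 = 0" using n by simp
    then have "b^2 = 0" "(2 * a + b)^2 = 0"
      using zero_le_power2[of "2 * a + b"] zero_le_power2[of b] by linarith+
    then show ?thesis by simp
  qed
  have "ring_iso_graph J"
    unfolding ring_iso_graph_def
  proof (intro conjI allI impI)
    show "(1, 1) \<in> J" by (rule JI[of _ 1 0]) simp_all
    fix u v u' v' assume "(u, v) \<in> J" "(u', v') \<in> J"
    then obtain a b a' b' where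
      uv: "u = of_int a + of_int b * z0" "v = of_int a + of_int b * z"
      "u' = of_int a' + of_int b' * z0" "v' = of_int a' + of_int b' * z"
      unfolding J_def by blast
    show "(u - u', v - v') \<in> J"
      by (rule JI[of _ "a - a'" "b - b'"]) (simp_all add: uv algebra_simps)
    have mul: "(of_int a + of_int b * z) * (of_int a' + of_int b' * z) =
      of_int (a * a' - b * b') + of_int (a * b' + b * a' + b * b') * z"
      if "z^2 - z + 1 = 0" for z :: complex
      using that by simp algebra
    show "(u * u', v * v') \<in> J"
      unfolding uv by (rule JI[OF mul[OF z0] mul[OF z]])
  next
    fix u v assume "(u, v) \<in> J"
    then obtain a b where uv: "u = of_int a + of_int b * z0" "v = of_int a + of_int b * z"
      unfolding J_def by blast
    show "u = 0 \<longleftrightarrow> v = 0"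
      unfolding uv using zero[OF z0, of a b] zero[OF z, of a b] by auto
  qed
  moreover have "(z0, z) \<in> J" by (rule JI[of _ 0 1]) simp_all
  ultimately show ?thesis by blast
qed

subsection \<open>Traces of elements of finite order\<close>

text \<open>Zeros of \<open>cheb n\<close> are the traces of noncentral elements whose order in
  PSL(2) divides \<open>n\<close>; \<open>x = 0\<close> and \<open>x^2 = 1\<close> belong to orders
  2 and 3. The bounds on \<open>r\<close> make the norm form of
  \<open>ring_iso_graph_quadratic\<close> definite.\<close>

definition trace_class :: "nat \<Rightarrow> complex set \<Rightarrow> real \<Rightarrow> bool" where
  "trace_class n T r \<longleftrightarrow> 1 < r^2 \<and> r^2 < 5 \<and> (\<forall>x\<in>T. conjugate_numbers x (of_real r)) \<and>
     (\<forall>x. cheb n x = 0 \<longrightarrow> x \<noteq> 0 \<longrightarrow> x^2 \<noteq> 1 \<longrightarrow> x \<in> T \<or> - x \<in> T)"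

lemma trace_class_4: "trace_class 4 {x. x^2 = 2} (sqrt 2)"
  unfolding trace_class_def
proof (intro conjI ballI allI impI)
  have eis: "eisenstein 2 [:-2, 0, 1:]"
    by (auto simp: eisenstein_def less_Suc_eq)
  show "conjugate_numbers x (of_real (sqrt 2))" if "x \<in> {x. x^2 = 2}" for x
    using that by (intro eisenstein_roots_conjugate[OF eis])
      (auto simp: power2_eq_square of_real_mult[symmetric] simp del: of_real_mult)
  show "x \<in> {x. x^2 = 2} \<or> - x \<in> {x. x^2 = 2}" if "cheb 4 x = 0" "x \<noteq> 0" for x
  proof -
    have "cheb 4 x = x * (x^2 - 2)" by (simp add: eval_nat_numeral algebra_simps)
    then show ?thesis using that by simp
  qed
qed simp_all

lemma trace_class_6: "trace_class 6 {x. x^2 = 3} (sqrt 3)"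
  unfolding trace_class_def
proof (intro conjI ballI allI impI)
  have eis: "eisenstein 3 [:-3, 0, 1:]"
    by (auto simp: eisenstein_def less_Suc_eq)
  show "conjugate_numbers x (of_real (sqrt 3))" if "x \<in> {x. x^2 = 3}" for x
    using that by (intro eisenstein_roots_conjugate[OF eis])
      (auto simp: power2_eq_square of_real_mult[symmetric] simp del: of_real_mult)
  show "x \<in> {x. x^2 = 3} \<or> - x \<in> {x. x^2 = 3}" if "cheb 6 x = 0" "x \<noteq> 0" "x^2 \<noteq> 1" for x
  proof -
    have "cheb 6 x = x * (x^2 - 1) * (x^2 - 3)" by (simp add: eval_nat_numeral algebra_simps)
    then show ?thesis using that by simp
  qed
qed simp_all

text \<open>The roots of the cubic are \<open>2 cos (2 k pi / 9)\<close> for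
  \<open>k = 1, 2, 4\<close>, and it becomes Eisenstein at 3 in the variable
  \<open>x + 1\<close>.\<close>

lemma trace_class_9: "\<exists>r. trace_class 9 {x. x^3 - 3 * x + 1 = 0} r"
proof -
  have "\<exists>r::real. 1 \<le> r \<and> r \<le> 2 \<and> r^3 - 3 * r + 1 = 0"
    by (rule IVT') (auto intro!: continuous_intros)
  then obtain r :: real where r: "1 \<le> r" "r \<le> 2" "r^3 - 3 * r + 1 = 0" by blast
  have "r \<noteq> 1" "r \<noteq> -1" using r by auto
  have eis: "eisenstein 3 [:3, 0, -3, 1:]"
    by (auto simp: eisenstein_def less_Suc_eq)
  have conj: "conjugate_numbers x y" if "x^3 - 3 * x + 1 = 0" "y^3 - 3 * y + 1 = 0" for x y
  proof -
    have "int_poly_at [:3, 0, -3, 1:] (x + 1) = x^3 - 3 * x + 1" for x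
      by (simp add: power3_eq_cube algebra_simps)
    then have "conjugate_numbers (x + 1) (y + 1)"
      using eisenstein_roots_conjugate[OF eis] that by metis
    then show ?thesis using conjugate_numbers_int_poly_at[of "x + 1" "y + 1" "[:-1, 1:]"] by simp
  qed
  have "trace_class 9 {x. x^3 - 3 * x + 1 = 0} r"
    unfolding trace_class_def
  proof (intro conjI ballI allI impI)
    have "1 < r" using r \<open>r \<noteq> 1\<close> by simp
    then show "1 < r^2" by (simp add: one_less_power)
    have "r^2 \<le> 2^2" using r by (intro power_mono) auto
    then show "r^2 < 5" by simp
    have "complex_of_real (r^3 - 3 * r + 1) = 0" using r by simp
    then show "conjugate_numbers x (of_real r)" if "x \<in> {x. x^3 - 3 * x + 1 = 0}" for x
      using that by (intro conj) auto
    show "x \<in> {x. x^3 - 3 * x + 1 = 0} \<or> - x \<in> {x. x^3 - 3 * x + 1 = 0}"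
      if "cheb 9 x = 0" "x^2 \<noteq> 1" for x
    proof -
      \<comment> \<open>The factor \<open>x^3 - 3 * x - 1\<close> is written as minus the same cubic
        at \<open>- x\<close>, which accounts for the choice of sign.\<close>
      have "cheb 9 x = (x^2 - 1) * (x^3 - 3 * x + 1) * (- ((- x)^3 - 3 * (- x) + 1))"
        by (simp add: eval_nat_numeral algebra_simps)
      then have "x^3 - 3 * x + 1 = 0 \<or> (- x)^3 - 3 * (- x) + 1 = 0"
        using that by (metis mult_eq_0_iff neg_equal_0_iff_equal right_minus_eq)
      then show ?thesis by blast
    qed
  qed
  then show ?thesis ..
qed

section \<open>Zeros of \<open>cheb\<close> and roots of unity\<close>

lemma cheb_mult_diff:
  assumes "m * n = 1"
  shows "cheb k (m + n) * (m - n) = m ^ k - n ^ k"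
proof (induction k "m + n" rule: cheb.induct)
  case (3 k)
  have "(m + n) * (m ^ Suc k - n ^ Suc k) - (m ^ k - n ^ k) = m ^ Suc (Suc k) - n ^ Suc (Suc k)
     + (m * n - 1) * (m ^ k - n ^ k)"
    by (simp add: algebra_simps)
  then show ?case using 3 assms by (simp add: left_diff_distrib mult.assoc)
qed simp_all

lemma cheb_2: "cheb k 2 = of_nat k"
  by (induction k "2 :: complex" rule: cheb.induct) simp_all

lemma cheb_minus_2: "cheb k (- 2) = - ((- 1) ^ k * of_nat k)"
  by (induction k "- 2 :: complex" rule: cheb.induct) (simp_all add: algebra_simps)

text \<open>Take for \<open>m\<close> an eigenvalue of a matrix of determinant 1 and trace
  \<open>x\<close>. Then \<open>m ^ k\<close> is its own inverse, and as \<open>k\<close> is odd the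
  case \<open>m ^ k = -1\<close> passes to \<open>- m\<close> and \<open>- x\<close>. The inverse of
  \<open>m\<close> is written \<open>m ^ (k - 1)\<close> to stay polynomial.\<close>

lemma cheb_zero_root_of_unity:
  assumes "cheb k x = 0" "k > 0" "odd k"
  shows "\<exists>m. m ^ k = 1 \<and> m \<noteq> 1 \<and> (x = m + m ^ (k - 1) \<or> - x = m + m ^ (k - 1))"
proof -
  define m where "m = (x + csqrt (x^2 - 4)) / 2"
  define n where "n = (x - csqrt (x^2 - 4)) / 2"
  have mn: "m * n = 1" "m + n = x"
  proof -
    have "m * n = (x^2 - (csqrt (x^2 - 4))^2) / 4"
      unfolding m_def n_def by (simp add: power2_eq_square algebra_simps)
    then show "m * n = 1" by (simp only: power2_csqrt) simp
    show "m + n = x" unfolding m_def n_def by (simp add: field_simps)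
  qed
  have "m ^ k = n ^ k" using cheb_mult_diff[OF mn(1), of k] mn(2) assms(1) by simp
  then have "m ^ k * m ^ k = (m * n) ^ k" by (simp add: power_mult_distrib)
  then have "(m ^ k)^2 = 1" using mn by (simp add: power2_eq_square)
  then have mk: "m ^ k = 1 \<or> m ^ k = -1" by (simp add: power2_eq_1_iff)
  \<comment> \<open>Eigenvalues 1 and -1 give \<open>x = 2\<close> and \<open>x = -2\<close>, where
    \<open>cheb k\<close> has absolute value \<open>k\<close>.\<close>
  have m1: "m \<noteq> 1" "m \<noteq> -1"
  proof -
    show "m \<noteq> 1"
    proof
      assume "m = 1"
      then have "x = 2" using mn by simp
      then show False using assms cheb_2 by simp
    qed
    show "m \<noteq> -1"
    proof
      assume m: "m = -1"
      then have "n = -1" using mn by (simp add: minus_equation_iff)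
      then have "x = -2" using mn m by simp
      then show False using assms cheb_minus_2[of k] by simp
    qed
  qed
  have inv: "m = l \<Longrightarrow> l ^ k = 1 \<Longrightarrow> n = l ^ (k - 1)" for l
    using mn assms(2) by (metis mult.left_commute mult.right_neutral power_eq_if not_gr0)
  from mk show ?thesis
  proof
    assume 1: "m ^ k = 1"
    then show ?thesis using inv[OF HOL.refl 1] m1 mn(2) by blast
  next
    assume "m ^ k = -1"
    then have 1: "(- m) ^ k = 1" using assms(3) by simp
    have "- m * (- m) ^ (k - 1) = - m * - n"
      using 1 mn(1) assms(2) by (metis minus_mult_minus power_eq_if not_gr0)
    moreover have "- m \<noteq> 0" using mn by auto
    ultimately have "(- m) ^ (k - 1) = - n" by (metis mult_left_cancel)
    then have "- x = - m + (- m) ^ (k - 1)" using mn(2)[symmetric] by simp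
    moreover have "- m \<noteq> 1" using m1 by (metis minus_minus)
    ultimately show ?thesis using 1 by blast
  qed
qed

text \<open>\<open>f\<close> is \<open>((X + 1)^p - 1) / X\<close>, the shifted cyclotomic
  polynomial, which is Eisenstein at \<open>p\<close>. The two sums are the same integral polynomial
  in \<open>m - 1\<close> and \<open>l - 1\<close>.\<close>

lemma prime_roots_of_unity_conjugate:
  assumes p: "prime p" and m: "m ^ p = 1" "m \<noteq> 1" and l: "l ^ p = 1" "l \<noteq> 1"
  shows "conjugate_numbers (m + m ^ (p - 1)) (l + l ^ (p - 1))"
proof -
  define f :: "int poly" where "f = (\<Sum>k<p. monom (int (p choose Suc k)) k)"
  have p0: "p > 1" using p by (rule prime_gt_1_nat)
  have coeff: "coeff f k = (if k < p then int (p choose Suc k) else 0)" for k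
    unfolding f_def by (simp add: coeff_sum)
  have deg: "degree f = p - 1"
  proof (rule antisym)
    show "degree f \<le> p - 1" by (rule degree_le) (use p0 in \<open>auto simp: coeff\<close>)
    show "p - 1 \<le> degree f" by (rule le_degree) (use p0 in \<open>simp add: coeff\<close>)
  qed
  have eis: "eisenstein (int p) f"
    unfolding eisenstein_def deg
  proof (intro conjI allI impI)
    show "prime (int p)" using p by simp
    show "coeff f (p - 1) = 1" "p - 1 > 0" using p0 by (simp_all add: coeff)
    show "int p dvd coeff f i" if "i < p - 1" for i
      using that dvd_choose_prime[of "Suc i" p] p by (auto simp: coeff)
    show "\<not> (int p)^2 dvd coeff f 0"
    proof
      assume "(int p)^2 dvd coeff f 0"
      then have "(int p)^2 dvd int p" using p0 by (simp add: coeff)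
      then have "(int p)^2 \<le> int p" using p0 by (intro zdvd_imp_le) auto
      then show False using p0 by (simp add: power2_eq_square)
    qed
  qed
  have root: "int_poly_at f (m - 1) = 0" if "m ^ p = 1" "m \<noteq> 1" for m
  proof -
    have "m ^ p = ((m - 1) + 1) ^ p" by simp
    also have "\<dots> = (\<Sum>k\<le>p. of_nat (p choose k) * (m - 1) ^ k)"
      by (subst binomial_ring) simp
    also have "\<dots> = 1 + (\<Sum>k<p. of_nat (p choose Suc k) * (m - 1) ^ Suc k)"
      by (subst lessThan_Suc_atMost[symmetric], subst sum.lessThan_Suc_shift) simp
    also have "(\<Sum>k<p. of_nat (p choose Suc k) * (m - 1) ^ Suc k) = (m - 1) * int_poly_at f (m - 1)"
      unfolding f_def by (simp add: sum_distrib_left mult_ac)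
    finally show ?thesis using that by simp
  qed
  have "conjugate_numbers (m - 1) (l - 1)"
    using eisenstein_roots_conjugate[OF eis root[OF m] root[OF l]] .
  then show ?thesis
    using conjugate_numbers_int_poly_at[of "m - 1" "l - 1" "[:1, 1:] + [:1, 1:] ^ (p - 1)"] by simp
qed

text \<open>For odd \<open>p\<close> the number \<open>l = - cis (pi / p)\<close> is a
  \<open>p\<close>-th root of unity, so \<open>l + l^-1 = - 2 * cos (pi / p)\<close> is a real
  conjugate; \<open>p >= 5\<close> puts its absolute value above 1.\<close>

lemma trace_class_prime:
  assumes p: "prime p" "p \<ge> 5"
  shows "trace_class p {m + m ^ (p - 1) | m. m ^ p = 1 \<and> m \<noteq> 1} (- 2 * cos (pi / p))"
  unfolding trace_class_def
proof (intro conjI ballI allI impI)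
  have odd: "odd p" using p prime_odd_nat[of p] by simp
  have c: "cos (pi / p) > 1 / 2"
  proof -
    have "cos (pi / p) > cos (pi / 3)"
      using p(2) by (intro cos_monotone_0_pi) (auto simp: field_simps)
    then show ?thesis by (simp add: cos_60)
  qed
  show "1 < (- 2 * cos (pi / p))^2"
  proof -
    have "1 < 2 * cos (pi / p)" using c by simp
    then have "1 < (2 * cos (pi / p))^2" by (simp only: one_less_power zero_less_numeral)
    then show ?thesis by simp
  qed
  have "(cos (pi / p))^2 \<le> 1" using abs_cos_le_one[of "pi / p"] by (simp add: abs_square_le_1)
  then show "(- 2 * cos (pi / p))^2 < 5" by (simp add: power_mult_distrib)
  define l where "l = - cis (pi / p)"
  have l: "l ^ p = 1"
    unfolding l_def using odd p(2) by (simp add: Complex.DeMoivre)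
  have inv: "l * - cis (- pi / p) = 1" unfolding l_def by (simp add: cis_mult)
  have "l * l ^ (p - 1) = 1" using l p(2) by (metis One_nat_def not_numeral_le_zero power_eq_if)
  then have "l * l ^ (p - 1) = l * - cis (- pi / p)" using inv by metis
  moreover have "l \<noteq> 0" using inv by auto
  ultimately have l': "l ^ (p - 1) = - cis (- pi / p)" by (metis mult_left_cancel)
  have lsum: "l + l ^ (p - 1) = of_real (- 2 * cos (pi / p))"
    unfolding l' unfolding l_def by (simp add: complex_eq_iff)
  have l1: "l \<noteq> 1"
  proof
    assume "l = 1"
    then have "complex_of_real (- 2 * cos (pi / p)) = of_real 2" using lsum by simp
    then have "- 2 * cos (pi / p) = 2" by (simp only: of_real_eq_iff)
    then show False using c by simp
  qed
  show "conjugate_numbers x (of_real (- 2 * cos (pi / p)))" if "x \<in> {m + m ^ (p - 1) | m. m ^ p = 1 \<and> m \<noteq> 1}" for x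
    using that prime_roots_of_unity_conjugate[OF p(1) _ _ l l1] unfolding lsum by blast
  show "x \<in> {m + m ^ (p - 1) | m. m ^ p = 1 \<and> m \<noteq> 1} \<or> - x \<in> {m + m ^ (p - 1) | m. m ^ p = 1 \<and> m \<noteq> 1}"
    if "cheb p x = 0" for x
    using cheb_zero_root_of_unity[OF that _ odd] p(2) by auto
qed

subsection \<open>Finitely presented groups\<close>

lemma word_eq_append_cong: "word_eq R u v \<Longrightarrow> word_eq R (x @ u @ y) (x @ v @ y)"
proof (induction rule: word_eq.induct)
  case (cancel u l v)
  then show ?case using word_eq.cancel[of R "x @ u" l "v @ y"] by simp
next
  case (relator r u v)
  then show ?case using word_eq.relator[of r R "x @ u" "v @ y"] by simp
qed (blast intro: word_eq.intros)+

lemma word_eq_append: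
  assumes "word_eq R u u'" "word_eq R v v'"
  shows "word_eq R (u @ v) (u' @ v')"
  using word_eq_append_cong[OF assms(1), of "[]" v] word_eq_append_cong[OF assms(2), of u' "[]"]
  by (auto intro: word_eq.trans)

lemma word_class_eq_iff: "word_class R u = word_class R v \<longleftrightarrow> word_eq R u v"
  unfolding word_class_def by (blast intro: word_eq.refl word_eq.sym word_eq.trans)

lemma fp_group_mult: "word_class R u \<otimes>\<^bsub>fp_group R\<^esub> word_class R v = word_class R (u @ v)"
proof -
  have "{z. \<exists>x\<in>word_class R u. \<exists>y\<in>word_class R v. word_eq R z (x @ y)} = word_class R (u @ v)"
    unfolding word_class_def by (blast intro: word_eq.refl word_eq.trans word_eq_append)
  then show ?thesis unfolding fp_group_def by simp
qed

lemma fp_group_one: "\<one>\<^bsub>fp_group R\<^esub> = word_class R []"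
  by (simp add: fp_group_def)

lemma fp_group_carrier: "carrier (fp_group R) = range (word_class R)"
  by (simp add: fp_group_def)

lemma inv_letter_inv_letter [simp]: "inv_letter (inv_letter x) = x"
  by (simp add: inv_letter_def)

lemma word_eq_inverse: "word_eq R (rev (map inv_letter w) @ w) []"
proof (induction w)
  case Nil
  show ?case by (simp add: word_eq.refl)
next
  case (Cons x w)
  have "word_eq R (rev (map inv_letter w) @ [inv_letter x, inv_letter (inv_letter x)] @ w) (rev (map inv_letter w) @ w)"
    by (rule word_eq.cancel)
  then show ?case using Cons by (auto intro: word_eq.trans)
qed

lemma group_fp_group: "group (fp_group R)"
proof (rule groupI)
  fix x assume "x \<in> carrier (fp_group R)"
  then obtain w where "x = word_class R w" unfolding fp_group_carrier by blast
  then have "word_class R (rev (map inv_letter w)) \<otimes>\<^bsub>fp_group R\<^esub> x = \<one>\<^bsub>fp_group R\<^esub>"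
    by (simp add: fp_group_mult fp_group_one word_class_eq_iff word_eq_inverse)
  then show "\<exists>y\<in>carrier (fp_group R). y \<otimes>\<^bsub>fp_group R\<^esub> x = \<one>\<^bsub>fp_group R\<^esub>"
    unfolding fp_group_carrier by blast
qed (auto simp: fp_group_carrier fp_group_mult fp_group_one)

lemma fp_group_inv: "inv\<^bsub>fp_group R\<^esub> (word_class R w) = word_class R (rev (map inv_letter w))"
proof -
  interpret group "fp_group R" by (rule group_fp_group)
  show ?thesis
    by (rule inv_equality)
       (auto simp: fp_group_carrier fp_group_mult fp_group_one word_class_eq_iff word_eq_inverse)
qed

lemma fp_group_relator: "r \<in> R \<Longrightarrow> word_class R r = \<one>\<^bsub>fp_group R\<^esub>"
  using word_eq.relator[of r R "[]" "[]"] by (simp add: fp_group_one word_class_eq_iff)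

lemma fp_group_pow: "word_class R [x] [^]\<^bsub>fp_group R\<^esub> n = word_class R (replicate n x)"
proof (induction n)
  case 0
  then show ?case by (simp add: fp_group_one)
next
  case (Suc n)
  then show ?case by (simp add: fp_group_mult replicate_append_same)
qed

lemma fp_group_generate:
  "carrier (fp_group R) \<subseteq> generate (fp_group R) {word_class R [gen_a], word_class R [gen_b]}"
proof
  interpret group "fp_group R" by (rule group_fp_group)
  let ?S = "{word_class R [gen_a], word_class R [gen_b]}"
  have letter: "word_class R [x] \<in> generate (fp_group R) ?S" for x
  proof -
    have "word_class R [gen_A] = inv\<^bsub>fp_group R\<^esub> (word_class R [gen_a])"
      "word_class R [gen_B] = inv\<^bsub>fp_group R\<^esub> (word_class R [gen_b])"
      by (simp_all add: fp_group_inv inv_letter_def gen_a_def gen_A_def gen_b_def gen_B_def)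
    moreover have "x = gen_a \<or> x = gen_b \<or> x = gen_A \<or> x = gen_B"
      unfolding gen_a_def gen_A_def gen_b_def gen_B_def by (cases x) auto
    ultimately show ?thesis
      by (metis generate.incl generate.inv insertI1 insertI2)
  qed
  fix y assume "y \<in> carrier (fp_group R)"
  then obtain w where "y = word_class R w" unfolding fp_group_carrier by blast
  moreover have "word_class R w \<in> generate (fp_group R) ?S"
  proof (induction w)
    case Nil
    then show ?case using generate.one[of "fp_group R"] by (simp add: fp_group_one)
  next
    case (Cons x w)
    then show ?case using generate.eng[OF letter[of x] Cons] by (simp add: fp_group_mult)
  qed
  ultimately show "y \<in> generate (fp_group R) ?S" by simp
qed

lemma Delta_presentation:
  obtains g h where "group (Delta n)" "g \<in> carrier (Delta n)" "h \<in> carrier (Delta n)"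
    "carrier (Delta n) \<subseteq> generate (Delta n) {g, h}"
    "g \<otimes>\<^bsub>Delta n\<^esub> inv\<^bsub>Delta n\<^esub> h \<otimes>\<^bsub>Delta n\<^esub> inv\<^bsub>Delta n\<^esub> g \<otimes>\<^bsub>Delta n\<^esub> h \<otimes>\<^bsub>Delta n\<^esub> g =
      h \<otimes>\<^bsub>Delta n\<^esub> (g \<otimes>\<^bsub>Delta n\<^esub> inv\<^bsub>Delta n\<^esub> h \<otimes>\<^bsub>Delta n\<^esub> inv\<^bsub>Delta n\<^esub> g \<otimes>\<^bsub>Delta n\<^esub> h)"
    "g [^]\<^bsub>Delta n\<^esub> n = \<one>\<^bsub>Delta n\<^esub>"
proof -
  define R where "R = {fig8_relator, replicate n gen_a}"
  have D: "Delta n = fp_group R" unfolding Delta_def R_def ..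
  interpret group "fp_group R" by (rule group_fp_group)
  let ?g = "word_class R [gen_a]" and ?h = "word_class R [gen_b]"
  have cl: "?g \<in> carrier (fp_group R)" "?h \<in> carrier (fp_group R)"
    by (simp_all add: fp_group_carrier)
  define w where "w = word_class R [gen_a, gen_B, gen_A, gen_b]"
  have inv_letters: "inv_letter gen_a = gen_A" "inv_letter gen_b = gen_B" "inv_letter gen_A = gen_a" "inv_letter gen_B = gen_b"
    by (simp_all add: inv_letter_def gen_a_def gen_A_def gen_b_def gen_B_def)
  have w: "w \<in> carrier (fp_group R)" unfolding w_def by (simp add: fp_group_carrier)
  have weq: "?g \<otimes>\<^bsub>fp_group R\<^esub> inv\<^bsub>fp_group R\<^esub> ?h \<otimes>\<^bsub>fp_group R\<^esub> inv\<^bsub>fp_group R\<^esub> ?g \<otimes>\<^bsub>fp_group R\<^esub> ?h = w"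
    unfolding w_def by (simp add: fp_group_inv fp_group_mult inv_letters)
  have "w \<otimes>\<^bsub>fp_group R\<^esub> ?g \<otimes>\<^bsub>fp_group R\<^esub> inv\<^bsub>fp_group R\<^esub> w \<otimes>\<^bsub>fp_group R\<^esub> inv\<^bsub>fp_group R\<^esub> ?h = word_class R fig8_relator"
    unfolding w_def fig8_relator_def by (simp add: fp_group_inv fp_group_mult inv_letters)
  then have "w \<otimes>\<^bsub>fp_group R\<^esub> ?g \<otimes>\<^bsub>fp_group R\<^esub> inv\<^bsub>fp_group R\<^esub> w \<otimes>\<^bsub>fp_group R\<^esub> inv\<^bsub>fp_group R\<^esub> ?h = \<one>\<^bsub>fp_group R\<^esub>"
    using fp_group_relator[of fig8_relator R] unfolding R_def by simp
  then have "w \<otimes>\<^bsub>fp_group R\<^esub> ?g \<otimes>\<^bsub>fp_group R\<^esub> inv\<^bsub>fp_group R\<^esub> w = ?h"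
    using cl w by (metis inv_closed inv_equality inv_inv m_closed)
  then have "w \<otimes>\<^bsub>fp_group R\<^esub> ?g = ?h \<otimes>\<^bsub>fp_group R\<^esub> w"
    using cl w by (metis inv_solve_right m_closed)
  moreover have "?g [^]\<^bsub>fp_group R\<^esub> n = \<one>\<^bsub>fp_group R\<^esub>"
    unfolding fp_group_pow by (rule fp_group_relator) (simp add: R_def)
  ultimately show ?thesis
    using that[of ?g ?h] cl fp_group_generate group_fp_group weq unfolding D by simp
qed

subsection \<open>The derived subgroup\<close>

context group
begin

lemma inv_cancel_left:
  assumes "x \<in> carrier G" "y \<in> carrier G"
  shows "inv x \<otimes> (x \<otimes> y) = y" "x \<otimes> (inv x \<otimes> y) = y"
  using assms by (simp_all add: m_assoc[symmetric])

lemma conj_hom: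
  assumes "g \<in> carrier G" "x \<in> carrier G" "y \<in> carrier G"
  shows "g \<otimes> (x \<otimes> y) \<otimes> inv g = (g \<otimes> x \<otimes> inv g) \<otimes> (g \<otimes> y \<otimes> inv g)"
  using assms by (simp add: m_assoc inv_cancel_left)

lemma conj_pow_step:
  assumes "g \<in> carrier G" "x \<in> carrier G"
  shows "g [^] Suc k \<otimes> x \<otimes> inv (g [^] Suc k) = g \<otimes> (g [^] k \<otimes> x \<otimes> inv (g [^] k)) \<otimes> inv g"
  unfolding nat_pow_Suc2[OF assms(1)] using assms by (simp add: m_assoc inv_mult_group)

end

text \<open>With \<open>x\<^sub>0 = g h\<inverse>\<close> and \<open>x\<^sub>1 = [g, x\<^sub>0]\<close>, conjugation by \<open>g\<close> is the shift
  \<open>x\<^sub>j \<mapsto> x\<^bsub>j+2\<^esub>\<close>; hence the Fibonacci group \<open>F(2,8)\<close> appears when \<open>g\<^sup>4 = 1\<close>.\<close>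
lemma fig8_derived_fibonacci:
  fixes G (structure)
  assumes "group G" and gh: "g \<in> carrier G" "h \<in> carrier G" and gen: "carrier G \<subseteq> generate G {g, h}"
    and rel: "g \<otimes> inv h \<otimes> inv g \<otimes> h \<otimes> g = h \<otimes> (g \<otimes> inv h \<otimes> inv g \<otimes> h)"
    and pow: "g [^] (4::nat) = \<one>"
  obtains f where "\<And>j. f j \<in> derived G (carrier G)" "derived G (carrier G) = generate G {f 0, f (1::nat)}"
    "\<And>j. f (Suc (Suc j)) = f (Suc j) \<otimes> f j" "f 8 = f 0" "f 9 = f 1"
proof -
  interpret group G by fact
  define w where "w = g \<otimes> inv h \<otimes> inv g \<otimes> h"
  have w: "w \<in> carrier G" unfolding w_def using gh by simp
  have wg: "w \<otimes> g = h \<otimes> w" unfolding w_def by (rule rel)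
  define a where "a = g \<otimes> inv h"
  have a: "a \<in> carrier G" unfolding a_def using gh by simp
  define b where "b = g \<otimes> a \<otimes> inv g \<otimes> inv a"
  have b: "b \<in> carrier G" unfolding b_def using gh a by simp
  have cw: "g \<otimes> w \<otimes> inv g = b"
    unfolding b_def a_def w_def using gh by (simp add: m_assoc inv_mult_group)
  \<comment> \<open>The relation gives \<open>w g^-1 = h^-1 w\<close>, so
    \<open>b = g w g^-1 = g h^-1 w = a w\<close>.\<close>
  have aw: "a \<otimes> w = b"
  proof -
    have "w \<otimes> inv g = inv h \<otimes> w"
      using wg gh w by (metis inv_solve_left inv_solve_right m_assoc m_closed inv_closed)
    then have "g \<otimes> (inv h \<otimes> w) = b"
      using cw gh w by (simp add: m_assoc)
    then show ?thesis unfolding a_def using gh w by (simp add: m_assoc)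
  qed
  have ca: "g \<otimes> a \<otimes> inv g = b \<otimes> a"
    unfolding b_def using gh a by (simp add: m_assoc)
  have cb: "g \<otimes> b \<otimes> inv g = b \<otimes> a \<otimes> b"
    using conj_hom[OF gh(1) a w] unfolding aw ca cw .
  define F where "F = rec_nat (a, b) (\<lambda>_ (x, y). (y, y \<otimes> x))"
  define f where "f j = fst (F j)" for j
  have snd: "snd (F j) = f (Suc j)" for j
    unfolding f_def F_def by (simp add: split_def)
  have rec: "f (Suc (Suc j)) = f (Suc j) \<otimes> f j" for j
  proof -
    have "f (Suc (Suc j)) = snd (F (Suc j))" by (rule snd[symmetric])
    also have "\<dots> = snd (F j) \<otimes> fst (F j)" unfolding F_def by (simp add: split_def)
    finally show ?thesis unfolding snd f_def[symmetric] .
  qed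
  have f01: "f 0 = a" "f 1 = b" unfolding f_def F_def by simp_all
  have fcl: "f j \<in> carrier G \<and> f (Suc j) \<in> carrier G" for j
    by (induction j) (use f01 a b rec in auto)
  have shift: "g \<otimes> f j \<otimes> inv g = f (Suc (Suc j)) \<and> g \<otimes> f (Suc j) \<otimes> inv g = f (Suc (Suc (Suc j)))" for j
  proof (induction j)
    case 0
    then show ?case using ca cb f01 by (simp add: rec)
  next
    case (Suc j)
    have "g \<otimes> f (Suc (Suc j)) \<otimes> inv g = f (Suc (Suc (Suc j))) \<otimes> f (Suc (Suc j))"
      unfolding rec[of j] using conj_hom[OF gh(1), of "f (Suc j)" "f j"] fcl[of j] Suc by (simp add: rec)
    then show ?case using Suc rec[of "Suc (Suc j)"] by simp
  qed
  have shift_pow: "g [^] (k::nat) \<otimes> f j \<otimes> inv (g [^] k) = f (j + 2 * k)" for k j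
  proof (induction k)
    case 0
    then show ?case using fcl[of j] by simp
  next
    case (Suc k)
    then show ?case
      unfolding conj_pow_step[OF gh(1) conjunct1[OF fcl[of j]]] using shift[of "j + 2 * k"] by simp
  qed
  \<comment> \<open>Conjugation by \<open>g^4 = 1\<close> is the shift by 8.\<close>
  have per: "f 8 = f 0" "f 9 = f 1"
    using shift_pow[of 4 0] shift_pow[of 4 1] pow fcl[of 0] by simp_all
  \<comment> \<open>\<open>H\<close> is normalised by \<open>g\<close>, and every element of the
    group is an element of \<open>H\<close> times a power of \<open>g\<close>. So the quotient by
    \<open>H\<close> is cyclic and \<open>H\<close> contains all commutators.\<close>
  define H where "H = generate G {a, b}"
  have subH: "subgroup H G" unfolding H_def using a b by (intro generate_is_subgroup) auto
  note Hm = subgroup.m_closed[OF subH] and Hi = subgroup.m_inv_closed[OF subH] and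
    Hc = subgroup.mem_carrier[OF subH] and H1 = subgroup.one_closed[OF subH]
  have aH: "a \<in> H" and bH: "b \<in> H" unfolding H_def by (auto intro: generate.incl)
  have conjH: "g \<otimes> t \<otimes> inv g \<in> H" if "t \<in> H" for t
    using that unfolding H_def
  proof (induction rule: generate.induct)
    case one
    then show ?case using gh H1 unfolding H_def by simp
  next
    case (incl t)
    then show ?case using ca cb aH bH Hm unfolding H_def by auto
  next
    case (inv t)
    have t: "t \<in> carrier G" using inv a b by auto
    have "g \<otimes> t \<otimes> inv g \<in> H" using inv ca cb aH bH Hm by auto
    then have "inv (g \<otimes> t \<otimes> inv g) \<in> H" by (rule Hi)
    moreover have "inv (g \<otimes> t \<otimes> inv g) = g \<otimes> inv t \<otimes> inv g"
      using gh t by (simp add: m_assoc inv_mult_group)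
    ultimately show ?case unfolding H_def by simp
  next
    case (eng s t)
    then show ?case
      using conj_hom[OF gh(1), of s t] Hm Hc unfolding H_def by metis
  qed
  have conj_powH: "g [^] (k::nat) \<otimes> t \<otimes> inv (g [^] k) \<in> H" if "t \<in> H" for t k
  proof (induction k)
    case 0
    then show ?case using that Hc[OF that] by simp
  next
    case (Suc k)
    then show ?case unfolding conj_pow_step[OF gh(1) Hc[OF that]] by (rule conjH)
  qed
  have prod: "(s \<otimes> g [^] k) \<otimes> (t \<otimes> g [^] l) = s \<otimes> (g [^] k \<otimes> t \<otimes> inv (g [^] k)) \<otimes> g [^] (k + l)"
    if "s \<in> H" "t \<in> H" for s t and k l :: nat
  proof -
    have "g [^] (k + l) = g [^] k \<otimes> g [^] l" using gh by (simp add: nat_pow_mult)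
    then show ?thesis using gh Hc[OF that(1)] Hc[OF that(2)] by (simp add: m_assoc inv_cancel_left)
  qed
  \<comment> \<open>Hence natural exponents suffice in \<open>Q\<close> below.\<close>
  have ginv: "inv g = g [^] (3::nat)"
  proof (rule inv_equality)
    show "g [^] (3::nat) \<otimes> g = \<one>" using pow gh by (simp add: eval_nat_numeral)
  qed (use gh in auto)
  define Q where "Q x \<longleftrightarrow> (\<exists>t\<in>H. \<exists>k::nat. x = t \<otimes> g [^] k)" for x
  have QI: "Q (t \<otimes> g [^] k)" if "t \<in> H" for t and k :: nat unfolding Q_def using that by blast
  have Qg: "Q g" using QI[OF H1, of 1] gh by simp
  have Qm: "Q (x \<otimes> y)" if xy: "Q x" "Q y" for x y
  proof -
    obtain s k t l where "s \<in> H" "x = s \<otimes> g [^] (k::nat)" "t \<in> H" "y = t \<otimes> g [^] (l::nat)"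
      using xy unfolding Q_def by blast
    then show ?thesis using prod[of s t k l] QI Hm conj_powH by metis
  qed
  have QH: "Q t" if "t \<in> H" for t using QI[OF that, of 0] Hc[OF that] by simp
  have Qgi: "Q (inv g)" using QI[OF H1, of 3] gh unfolding ginv by simp
  have h: "h = inv a \<otimes> g" "inv h = inv g \<otimes> a"
    unfolding a_def using gh by (simp_all add: inv_mult_group m_assoc)
      (simp_all add: m_assoc[symmetric])
  have Qh: "Q h" "Q (inv h)"
    unfolding h(2) by (subst h(1)) (intro Qm QH Hi aH Qg Qgi)+
  have Q: "Q x" if "x \<in> carrier G" for x
  proof -
    have "x \<in> generate G {g, h}" using that gen by blast
    then show ?thesis
    proof (induction rule: generate.induct)
      case one
      then show ?case by (rule QH[OF H1])
    next
      case (incl x)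
      then show ?case using Qg Qh by auto
    next
      case (inv x)
      then show ?case using Qgi Qh by auto
    next
      case (eng x y)
      then show ?case using Qm by blast
    qed
  qed
  \<comment> \<open>\<open>x y\<close> and \<open>y x\<close> end in the same power of
    \<open>g\<close>, which cancels in \<open>x y (y x)^-1\<close>.\<close>
  have comm: "x \<otimes> y \<otimes> inv x \<otimes> inv y \<in> H" if xy: "x \<in> carrier G" "y \<in> carrier G" for x y
  proof -
    obtain s k t l where st: "s \<in> H" "x = s \<otimes> g [^] (k::nat)" "t \<in> H" "y = t \<otimes> g [^] (l::nat)"
      using Q[OF xy(1)] Q[OF xy(2)] unfolding Q_def by blast
    define u where "u = s \<otimes> (g [^] k \<otimes> t \<otimes> inv (g [^] k))"
    define v where "v = t \<otimes> (g [^] l \<otimes> s \<otimes> inv (g [^] l))"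
    have uv: "u \<in> H" "v \<in> H" unfolding u_def v_def using st Hm conj_powH by blast+
    have xy': "x \<otimes> y = u \<otimes> g [^] (k + l)" "y \<otimes> x = v \<otimes> g [^] (k + l)"
      unfolding u_def v_def using prod[of s t k l] prod[of t s l k] st by (simp_all add: add.commute)
    have "x \<otimes> y \<otimes> inv x \<otimes> inv y = (x \<otimes> y) \<otimes> inv (y \<otimes> x)"
      using xy by (simp add: m_assoc inv_mult_group)
    also have "\<dots> = u \<otimes> inv v"
      unfolding xy' using Hc[OF uv(1)] Hc[OF uv(2)] gh by (simp add: m_assoc inv_mult_group inv_cancel_left)
    also have "\<dots> \<in> H" using uv Hm Hi by blast
    finally show ?thesis .
  qed
  have derH: "derived G (carrier G) \<subseteq> H"
    unfolding derived_def by (rule generate_subgroup_incl[OF _ subH]) (use comm in auto)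
  have commD: "x \<otimes> y \<otimes> inv x \<otimes> inv y \<in> derived G (carrier G)" if "x \<in> carrier G" "y \<in> carrier G" for x y
    unfolding derived_def using that by (intro generate.incl) blast
  have subD: "subgroup (derived G (carrier G)) G"
    by (rule derived_is_subgroup) simp
  have bD: "b \<in> derived G (carrier G)" unfolding b_def by (rule commD[OF gh(1) a])
  \<comment> \<open>From \<open>a w = b = g w g^-1\<close> the element \<open>a\<close> is itself a
    commutator.\<close>
  have "a = g \<otimes> w \<otimes> inv g \<otimes> inv w"
    using aw cw a w b by (metis inv_solve_right)
  then have aD: "a \<in> derived G (carrier G)" using commD[OF gh(1) w] by simp
  have HD: "derived G (carrier G) = generate G {f 0, f 1}"
    using derH generate_subgroup_incl[OF _ subD, of "{a, b}"] aD bD unfolding H_def f01 by blast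
  have "f j \<in> H \<and> f (Suc j) \<in> H" for j
    by (induction j) (use f01 aH bH rec Hm in auto)
  then have "f j \<in> derived G (carrier G)" for j
    unfolding HD f01 H_def by blast
  then show ?thesis using that[of f] HD rec per by blast
qed

subsection \<open>Galois rigidity\<close>

lemma Delta_galois_rigid:
  assumes T: "trace_class n T r" and n: "n > 0" and \<rho>0: "cocompact_lattice_rep (Delta n) \<rho>0"
  shows "galois_rigid (Delta n) \<rho>0"
proof (rule galois_rigidI)
  fix \<rho> assume \<rho>: "zariski_dense_rep (Delta n) \<rho>"
  have rep: "is_rep (Delta n) \<rho>0" "inj_on \<rho>0 (carrier (Delta n))"
    using \<rho>0 unfolding cocompact_lattice_rep_def by blast+
  note T = T[unfolded trace_class_def]
  show "\<exists>\<sigma>. galois_conjugate (Delta n) \<rho>0 \<sigma> \<rho>"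
  proof (rule Delta_presentation[of n])
    fix g h assume D: "group (Delta n)" "g \<in> carrier (Delta n)" "h \<in> carrier (Delta n)"
    "carrier (Delta n) \<subseteq> generate (Delta n) {g, h}"
    "g \<otimes>\<^bsub>Delta n\<^esub> inv\<^bsub>Delta n\<^esub> h \<otimes>\<^bsub>Delta n\<^esub> inv\<^bsub>Delta n\<^esub> g \<otimes>\<^bsub>Delta n\<^esub> h \<otimes>\<^bsub>Delta n\<^esub> g =
      h \<otimes>\<^bsub>Delta n\<^esub> (g \<otimes>\<^bsub>Delta n\<^esub> inv\<^bsub>Delta n\<^esub> h \<otimes>\<^bsub>Delta n\<^esub> inv\<^bsub>Delta n\<^esub> g \<otimes>\<^bsub>Delta n\<^esub> h)"
    "g [^]\<^bsub>Delta n\<^esub> n = \<one>\<^bsub>Delta n\<^esub>"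
    show ?thesis
      by (rule fig8_quotient_galois_conjugate[OF D n rep \<rho>, of T])
         (use T ring_iso_graph_quadratic in \<open>blast+\<close>)
  qed
qed

lemma Gamma_4_galois_rigid:
  assumes \<rho>0: "cocompact_lattice_rep (Gamma_n 4) \<rho>0"
  shows "galois_rigid (Gamma_n 4) \<rho>0"
proof (rule galois_rigidI)
  fix \<rho> assume \<rho>: "zariski_dense_rep (Gamma_n 4) \<rho>"
  have rep: "is_rep (Gamma_n 4) \<rho>0" "inj_on \<rho>0 (carrier (Gamma_n 4))"
    using \<rho>0 unfolding cocompact_lattice_rep_def by blast+
  obtain f where grp: "group (Delta 4)"
    and f: "\<And>j. f j \<in> derived (Delta 4) (carrier (Delta 4))"
    "derived (Delta 4) (carrier (Delta 4)) = generate (Delta 4) {f 0, f (1::nat)}"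
    "\<And>j. f (Suc (Suc j)) = f (Suc j) \<otimes>\<^bsub>Delta 4\<^esub> f j" "f 8 = f 0" "f 9 = f 1"
    by (rule Delta_presentation[of 4], rule fig8_derived_fibonacci) blast+
  interpret D: group "Delta 4" by (rule grp)
  have sub: "subgroup (derived (Delta 4) (carrier (Delta 4))) (Delta 4)"
    by (rule D.derived_is_subgroup) simp
  have G: "group (Gamma_n 4)"
    unfolding Gamma_n_def by (rule D.subgroup_imp_group[OF sub])
  have gen: "carrier (Gamma_n 4) \<subseteq> generate (Gamma_n 4) {f 0, f 1}"
  proof -
    have "generate (Gamma_n 4) {f 0, f 1} = generate (Delta 4) {f 0, f 1}"
      unfolding Gamma_n_def using f(1) by (intro D.generate_consistent[OF _ sub]) auto
    then show ?thesis using f(2) unfolding Gamma_n_def by simp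
  qed
  show "\<exists>\<sigma>. galois_conjugate (Gamma_n 4) \<rho>0 \<sigma> \<rho>"
    by (rule fib8_galois_conjugate[OF G _ gen _ f(4,5) rep \<rho> ring_iso_graph_eisenstein_integers])
       (use f(1,3) in \<open>simp_all add: Gamma_n_def\<close>)
qed

theorem theorem6p1:
  shows "(\<forall>p::nat. prime p \<and> p \<ge> 5 \<longrightarrow>
            (\<forall>\<rho>0. cocompact_lattice_rep (Delta p) \<rho>0 \<longrightarrow> galois_rigid (Delta p) \<rho>0))
       \<and> (\<forall>n\<in>{4, 6, 9::nat}.
            \<forall>\<rho>0. cocompact_lattice_rep (Delta n) \<rho>0 \<longrightarrow> galois_rigid (Delta n) \<rho>0)
       \<and> (\<forall>\<rho>0. cocompact_lattice_rep (Gamma_n 4) \<rho>0 \<longrightarrow> galois_rigid (Gamma_n 4) \<rho>0)"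
proof (intro conjI allI impI ballI)
  show "galois_rigid (Delta p) \<rho>0" if "prime p \<and> p \<ge> 5" "cocompact_lattice_rep (Delta p) \<rho>0" for p \<rho>0
    using that by (intro Delta_galois_rigid[OF trace_class_prime]) auto
  show "galois_rigid (Delta n) \<rho>0" if n: "n \<in> {4, 6, 9}" and \<rho>0: "cocompact_lattice_rep (Delta n) \<rho>0" for n \<rho>0
  proof -
    obtain T r where "trace_class n T r"
      using n trace_class_4 trace_class_6 trace_class_9 by auto
    then show ?thesis using n by (intro Delta_galois_rigid[OF _ _ \<rho>0]) auto
  qed
qed (rule Gamma_4_galois_rigid)

end
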